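(* Let $n\ge 1$ and let $f,g:\mathbb{R}^n\to\mathbb{R}$ be two integrable log-concave functions with $\int_{\mathbb{R}^n}f(x)\,dx>0$ and $\int_{\mathbb{R}^n}g(x)\,dx>0$. Assume that $f$ and $g$ have opposite barycenters, i.e. $$\frac{\int_{\mathbb{R}^n}x f(x)\,dx}{\int_{\mathbb{R}^n}f(x)\,dx}=-\frac{\int_{\mathbb{R}^n}x g(x)\,dx}{\int_{\mathbb{R}^n}g(x)\,dx},$$ and that $\Vert f\Vert_\infty=f(0)$ and $\Vert g\Vert_\infty=g(0)$. Then $$ \Vert f\Vert_\infty\Vert g\Vert_\infty\int_{\mathbb{R}^{n}}f(x)\,dx\int_{\mathbb{R}^n}g(y)\,dy\leq \exp\left(1+\mathrm{Ent}\left(\frac{f}{\Vert f\Vert_\infty}\right)+\mathrm{Ent}\left(\frac{g}{\Vert g\Vert_\infty}\right)\right)\,(f*g)(0)\int_{\mathbb{R}^n}(f\star g)(z)\,dz. $$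
   Context: A function $f:\mathbb{R}^n\to\mathbb{R}$ is log-concave if $f(x)=e^{-v(x)}$ with $v:\mathbb{R}^n\to(-\infty,\infty]$ convex (with $e^{-\infty}=0$). $\Vert f\Vert_\infty=\sup_{x\in\mathbb{R}^n}f(x)$. The convolution is $(f*g)(x)=\int_{\mathbb{R}^n}f(y)g(x-y)\,dy$, so $(f*g)(0)=\int_{\mathbb{R}^n}f(y)g(-y)\,dy$. The Asplund product is $(f\star g)(x)=\sup_{x_1+x_2=x}f(x_1)g(x_2)=\sup_{y\in\mathbb{R}^n}f(y)g(x-y)$. The entropy of an integrable log-concave function $f$ (with positive integral) is $$\mathrm{Ent}(f)=-\frac{\int_{\mathbb{R}^n}f(x)\log f(x)\,dx}{\int_{\mathbb{R}^n}f(x)\,dx},$$ with the convention $0\log 0=0$. *)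

theory Defs
  imports "HOL-Analysis.Analysis"
begin

text \<open>
  Integrals are taken with respect to \<^term>\<open>lebesgue\<close> rather than \<^term>\<open>lborel\<close>: a log-concave
  function is always Lebesgue measurable, but it need not be Borel measurable on the boundary of
  its support.
\<close>

text \<open>
  \<^const>\<open>convex_on\<close> only covers real-valued functions. Restricting to weights in the open unit
  interval makes the definition independent of the value of \<open>0 * \<infinity>\<close>.
\<close>

definition ext_convex :: "('a::real_vector \<Rightarrow> ereal) \<Rightarrow> bool" where
  "ext_convex v \<longleftrightarrow>
     (\<forall>x. v x \<noteq> -\<infinity>) \<and>
     (\<forall>x y. \<forall>t\<in>{0<..<1}.
        v ((1 - t) *\<^sub>R x + t *\<^sub>R y) \<le> ereal (1 - t) * v x + ereal t * v y)"

definition log_concave :: "('a::real_vector \<Rightarrow> real) \<Rightarrow> bool" where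
  "log_concave f \<longleftrightarrow>
     (\<exists>v. ext_convex v \<and>
        (\<forall>x. f x = (if v x = \<infinity> then 0 else exp (- real_of_ereal (v x)))))"

text \<open>
  The real-valued suprema below are genuine suprema whenever the functions involved are bounded
  above, as integrable log-concave functions are.
\<close>

definition sup_norm :: "('a \<Rightarrow> real) \<Rightarrow> real" where
  "sup_norm f = (SUP x. f x)"

definition convolution :: "('a::euclidean_space \<Rightarrow> real) \<Rightarrow> ('a \<Rightarrow> real) \<Rightarrow> 'a \<Rightarrow> real" where
  "convolution f g x = (LINT y|lebesgue. f y * g (x - y))"

definition asplund :: "('a::real_vector \<Rightarrow> real) \<Rightarrow> ('a \<Rightarrow> real) \<Rightarrow> 'a \<Rightarrow> real" where
  "asplund f g x = (SUP y. f y * g (x - y))"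

definition barycenter :: "('a::euclidean_space \<Rightarrow> real) \<Rightarrow> 'a" where
  "barycenter f = (LINT x|lebesgue. f x *\<^sub>R x) /\<^sub>R (LINT x|lebesgue. f x)"

text \<open>The convention \<open>0 log 0 = 0\<close> holds automatically.\<close>

definition Ent :: "('a::euclidean_space \<Rightarrow> real) \<Rightarrow> real" where
  "Ent f = - (LINT x|lebesgue. f x * ln (f x)) / (LINT x|lebesgue. f x)"

end

theory Submission
  imports Defs
begin

text \<open>
  The convolution \<open>h = f * g\<close> is log-concave by the Prekopa-Leindler inequality and its barycenter is
  the origin, so integrating a supporting line of \<open>ln h\<close> at the origin gives
  \<open>\<integral> h ln h \<le> M ln (h 0)\<close> with \<open>M = \<integral> f \<integral> g = \<integral> h\<close>. By Gibbs' inequality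
  the normalization of \<open>f \<star> g\<close> in place of \<open>h\<close> inside the logarithm only decreases the left-hand
  side, and \<open>ln (f x) + ln (g y) \<le> ln ((f \<star> g) (x + y))\<close> bounds the result below by the entropies
  of \<open>f\<close> and \<open>g\<close>. The factor \<open>e\<close> in the theorem is room to spare: it makes the separation of a
  point from the hypograph of \<open>ln h\<close> strict.

  Functions are replaced by their restrictions to the interior of their supports, which are Borel and
  almost everywhere unchanged. Integrability comes from exponential decay: by log-concavity
  \<open>sqrt (f x)\<close> is controlled by the integral of \<open>f\<close> over a ball that escapes to infinity with \<open>x\<close>.
\<close>

subsection \<open>The Prekopa-Leindler inequality\<close>

text \<open>The integral of \<open>h ln h\<close> is never formed. The pointwise inequality that is
  integrated has a nonnegative right-hand side, so a nonnegative integral suffices there, and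
  \<open>ln u \<le> u - 1\<close> multiplied by \<open>H\<close> leaves a constant multiple of
  \<open>Q\<close>. No integrability of \<open>H ln H\<close> or \<open>H ln Q\<close> has to be
  shown.

  Only the single point \<open>(0, c)\<close> is separated from the strict hypograph of
  \<open>ln H\<close>, and the hyperplane may be vertical or may touch, since nothing is known
  beforehand about the position of the origin in the support of \<open>H\<close>. A vertical
  hyperplane contradicts the position of the barycenter. Any other contradicts the integrated
  inequality: without the factor \<open>e\<close> this would read \<open>M \<le> M\<close>, with it
  \<open>2 M \<le> M\<close>.

  Strictness also explains \<open>geom_less\<close>: it speaks of real levels below extended values,
  so it covers infinite integrals, passes through iterated integration, and at the levels
  \<open>exp r\<close>, \<open>exp s\<close> it is convexity of the strict hypograph.\<close>

lemma emeasure_lborel_inner_compact: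
  fixes X :: "'a::euclidean_space set"
  assumes X: "X \<in> sets borel"
  shows "emeasure lborel X = (SUP K\<in>{K. compact K \<and> K \<subseteq> X}. emeasure lborel K)"
proof (rule antisym)
  show "(SUP K\<in>{K. compact K \<and> K \<subseteq> X}. emeasure lborel K) \<le> emeasure lborel X"
    by (intro SUP_least emeasure_mono) (use X in auto)
  \<comment> \<open>Inside a ball the closed inner approximations are compact; the balls are
    exhausted afterwards.\<close>
  have bd: "emeasure lborel (X \<inter> cball 0 n) \<le> (SUP K\<in>{K. compact K \<and> K \<subseteq> X}. emeasure lborel K)" for n :: nat
  proof (rule ennreal_le_epsilon)
    fix e :: real assume "0 < e"
    have Xl: "X \<inter> cball 0 n \<in> sets lebesgue"
      using X by auto
    obtain T where T: "closed T" "T \<subseteq> X \<inter> cball 0 n" "X \<inter> cball 0 n - T \<in> lmeasurable"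
        "emeasure lebesgue (X \<inter> cball 0 n - T) < ennreal e"
      using sets_lebesgue_inner_closed[OF Xl \<open>0 < e\<close>] by blast
    have "compact T"
      using T by (meson bounded_cball bounded_subset compact_eq_bounded_closed le_inf_iff)
    have "emeasure lborel (X \<inter> cball 0 n) = emeasure lborel (T \<union> (X \<inter> cball 0 n - T))"
      using T(2) by (intro arg_cong[where f="emeasure lborel"]) auto
    also have "\<dots> \<le> emeasure lborel T + emeasure lborel (X \<inter> cball 0 n - T)"
      using T(1) X by (intro emeasure_subadditive) auto
    also have "emeasure lborel (X \<inter> cball 0 n - T) \<le> ennreal e"
      using T(1,4) X by (simp add: less_imp_le)
    also have "emeasure lborel T \<le> (SUP K\<in>{K. compact K \<and> K \<subseteq> X}. emeasure lborel K)"
      using T(2) \<open>compact T\<close> by (intro SUP_upper) auto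
    finally show "emeasure lborel (X \<inter> cball 0 n)
        \<le> (SUP K\<in>{K. compact K \<and> K \<subseteq> X}. emeasure lborel K) + ennreal e"
      by (simp add: add_mono)
  qed
  have "X = (\<Union>n::nat. X \<inter> cball 0 n)"
    using real_arch_simple by auto
  then have "emeasure lborel X = emeasure lborel (\<Union>n::nat. X \<inter> cball 0 n)"
    by simp
  also have "\<dots> = (SUP n::nat. emeasure lborel (X \<inter> cball 0 n))"
    using X by (intro SUP_emeasure_incseq[symmetric]) (auto simp: incseq_def)
  also have "\<dots> \<le> (SUP K\<in>{K. compact K \<and> K \<subseteq> X}. emeasure lborel K)"
    by (intro SUP_least bd)
  finally show "emeasure lborel X \<le> (SUP K\<in>{K. compact K \<and> K \<subseteq> X}. emeasure lborel K)" .
qed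

text \<open>The affine images \<open>K'\<close> and \<open>L'\<close> below both lie in \<open>Z\<close> and overlap at most in one point.\<close>

lemma brunn_minkowski_compact_real:
  fixes K L Z :: "real set"
  assumes K: "compact K" "K \<noteq> {}" and L: "compact L" "L \<noteq> {}" and Z: "Z \<in> sets borel"
    and t: "0 < t" "t < 1"
    and sub: "\<And>x y. x \<in> K \<Longrightarrow> y \<in> L \<Longrightarrow> (1 - t) * x + t * y \<in> Z"
  shows "ennreal (1 - t) * emeasure lborel K + ennreal t * emeasure lborel L \<le> emeasure lborel Z"
proof -
  obtain k where k: "k \<in> K" "\<And>x. x \<in> K \<Longrightarrow> x \<le> k"
    using compact_attains_sup[OF K] by blast
  obtain l where l: "l \<in> L" "\<And>x. x \<in> L \<Longrightarrow> l \<le> x"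
    using compact_attains_inf[OF L] by blast
  define K' where "K' = (\<lambda>x. (1 - t) *\<^sub>R x + t * l) ` K"
  define L' where "L' = (\<lambda>x. t *\<^sub>R x + (1 - t) * k) ` L"
  have cK: "compact K'" and cL: "compact L'"
    unfolding K'_def L'_def by (auto intro!: compact_continuous_image continuous_intros K L)
  have bK[measurable]: "K' \<in> sets borel" "L' \<in> sets borel" "K \<in> sets borel" "L \<in> sets borel"
    using cK cL K L by (auto intro: borel_compact)
  have eK: "emeasure lborel K' = ennreal (1 - t) * emeasure lborel K"
    using emeasure_lebesgue_affine[of "1 - t" "t * l" K] t bK unfolding K'_def by simp
  have eL: "emeasure lborel L' = ennreal t * emeasure lborel L"
    using emeasure_lebesgue_affine[of t "(1 - t) * k" L] t bK unfolding L'_def by simp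
  have "K' \<inter> L' \<subseteq> {(1 - t) * k + t * l}"
  proof
    fix z assume "z \<in> K' \<inter> L'"
    then obtain x y where "x \<in> K" "y \<in> L" and z: "z = (1 - t) * x + t * l" "z = t * y + (1 - t) * k"
      by (auto simp: K'_def L'_def)
    then have "(1 - t) * x \<le> (1 - t) * k" "t * l \<le> t * y"
      using k l t by (auto intro!: mult_left_mono)
    moreover have "a = d" if "a + b = c + d" "a \<le> d" "b \<le> c" for a b c d :: real
      using that by linarith
    ultimately have "(1 - t) * x = (1 - t) * k"
      using z by metis
    then have "z = (1 - t) * k + t * l"
      using z(1) by simp
    then show "z \<in> {(1 - t) * k + t * l}"
      by simp
  qed
  then have "emeasure lborel (K' \<inter> L') \<le> emeasure lborel {(1 - t) * k + t * l}"
    by (intro emeasure_mono) auto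
  then have 0: "emeasure lborel (K' \<inter> L') = 0"
    by simp
  have "ennreal (1 - t) * emeasure lborel K + ennreal t * emeasure lborel L
      = emeasure lborel (K' \<union> L') + emeasure lborel (K' \<inter> L')"
    unfolding eK[symmetric] eL[symmetric] using bK by (intro emeasure_Un_Int) auto
  also have "\<dots> = emeasure lborel (K' \<union> L')"
    using 0 by simp
  also have "\<dots> \<le> emeasure lborel Z"
    using sub k(1) l(1) Z by (intro emeasure_mono) (auto simp: K'_def L'_def add.commute)
  finally show ?thesis .
qed

text \<open>The sum of two Borel sets need not be Borel, hence the measurable superset
  \<open>Z\<close>. Inner regularity reduces everything to compact sets.\<close>

lemma brunn_minkowski_real:
  fixes X Y Z :: "real set"
  assumes X: "X \<in> sets borel" "X \<noteq> {}" and Y: "Y \<in> sets borel" "Y \<noteq> {}" and Z: "Z \<in> sets borel"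
    and t: "0 < t" "t < 1"
    and sub: "\<And>x y. x \<in> X \<Longrightarrow> y \<in> Y \<Longrightarrow> (1 - t) * x + t * y \<in> Z"
  shows "ennreal (1 - t) * emeasure lborel X + ennreal t * emeasure lborel Y \<le> emeasure lborel Z"
proof -
  have KL: "ennreal (1 - t) * emeasure lborel K + ennreal t * emeasure lborel L \<le> emeasure lborel Z"
    if "compact K" "K \<subseteq> X" "compact L" "L \<subseteq> Y" for K L
  proof -
    \<comment> \<open>The compact subsets in the suprema may be empty, while the compact case needs
      nonempty sets; adjoining a point repairs this.\<close>
    obtain x y where xy: "x \<in> X" "y \<in> Y"
      using X Y by blast
    have "ennreal (1 - t) * emeasure lborel K + ennreal t * emeasure lborel L
        \<le> ennreal (1 - t) * emeasure lborel (insert x K) + ennreal t * emeasure lborel (insert y L)"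
      using that by (intro add_mono mult_left_mono emeasure_mono) (auto intro: borel_compact)
    also have "\<dots> \<le> emeasure lborel Z"
      using that xy Z t by (intro brunn_minkowski_compact_real sub) auto
    finally show ?thesis .
  qed
  have ne: "{K. compact K \<and> K \<subseteq> S} \<noteq> {}" for S :: "real set"
    by blast
  let ?KX = "{K. compact K \<and> K \<subseteq> X}" and ?KY = "{K. compact K \<and> K \<subseteq> Y}"
  have "ennreal (1 - t) * emeasure lborel X + ennreal t * emeasure lborel Y
      = (SUP K\<in>?KX. ennreal (1 - t) * emeasure lborel K) + (SUP L\<in>?KY. ennreal t * emeasure lborel L)"
    unfolding emeasure_lborel_inner_compact[OF X(1)] emeasure_lborel_inner_compact[OF Y(1)]
      SUP_mult_left_ennreal ..
  also have "\<dots> = (SUP K\<in>?KX. ennreal (1 - t) * emeasure lborel K + (SUP L\<in>?KY. ennreal t * emeasure lborel L))"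
    by (rule ennreal_SUP_add_left[OF ne, symmetric])
  also have "\<dots> = (SUP K\<in>?KX. SUP L\<in>?KY. ennreal (1 - t) * emeasure lborel K + ennreal t * emeasure lborel L)"
    by (intro SUP_cong refl ennreal_SUP_add_right[OF ne])
  also have "\<dots> \<le> emeasure lborel Z"
    by (intro SUP_least KL) auto
  finally show ?thesis .
qed

section \<open>Prekopa-Leindler on the line, from superlevel sets\<close>

lemma nn_integral_layer_cake:
  assumes [measurable]: "f \<in> borel_measurable lborel"
  shows "(\<integral>\<^sup>+x. f x \<partial>lborel)
    = (\<integral>\<^sup>+s. indicator {0..} s * emeasure lborel {x::'a::euclidean_space. ennreal s < f x} \<partial>lborel)"
proof -
  \<comment> \<open>For negative \<open>s\<close> the value \<open>ennreal s\<close> is 0, so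
    without \<open>0 \<le> s\<close> every positive value would be counted with infinite
    length.\<close>
  have fib: "f x = (\<integral>\<^sup>+s. indicator {s. 0 \<le> s \<and> ennreal s < f x} s \<partial>lborel)" for x
  proof (cases "f x")
    case (real r)
    then have "{s. 0 \<le> s \<and> ennreal s < f x} = {0..<r}"
      by (auto simp: ennreal_less_iff)
    then show ?thesis
      using real by simp
  next
    case top
    then have *: "{s. 0 \<le> s \<and> ennreal s < f x} = {0..}"
      by auto
    have "of_nat n \<le> emeasure lborel {0::real..}" for n
      using emeasure_mono[of "{0..real n}" "{0..}" lborel] by (simp add: ennreal_of_nat_eq_real_of_nat)
    then have "\<not> emeasure lborel {0::real..} < top"
      using ennreal_Ex_less_of_nat leD by blast
    then have "emeasure lborel {0::real..} = top"
      using top.not_eq_extremum by blast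
    then show ?thesis
      unfolding * using top by simp
  qed
  have "(\<integral>\<^sup>+x. f x \<partial>lborel) = (\<integral>\<^sup>+x. \<integral>\<^sup>+s. indicator {s. 0 \<le> s \<and> ennreal s < f x} s \<partial>lborel \<partial>lborel)"
    by (intro nn_integral_cong fib)
  also have "\<dots> = (\<integral>\<^sup>+s. \<integral>\<^sup>+x. indicator {s. 0 \<le> s \<and> ennreal s < f x} s \<partial>lborel \<partial>lborel)"
    by (intro lborel_pair.Fubini') (unfold indicator_def split_beta' mem_Collect_eq, measurable)
  also have "\<dots> = (\<integral>\<^sup>+s. \<integral>\<^sup>+x. indicator {0..} s * indicator {x. ennreal s < f x} x \<partial>lborel \<partial>lborel)"
    by (intro nn_integral_cong) (auto split: split_indicator)
  also have "\<dots> = (\<integral>\<^sup>+s. indicator {0..} s * emeasure lborel {x. ennreal s < f x} \<partial>lborel)"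
    by (intro nn_integral_cong) (simp add: nn_integral_cmult)
  finally show ?thesis .
qed

text \<open>Brunn-Minkowski needs two nonempty superlevel sets. Equal suprema ensure this: below
  level 1 both sets are nonempty, from level 1 on both are empty. This is why an arithmetic mean can
  appear in the conclusion.\<close>

lemma prekopa_leindler_real_normalized:
  fixes f g h :: "real \<Rightarrow> ennreal"
  assumes [measurable]: "f \<in> borel_measurable borel" "g \<in> borel_measurable borel" "h \<in> borel_measurable borel"
    and t: "0 < t" "t < 1"
    and le1: "\<And>x. f x \<le> 1" "\<And>x. g x \<le> 1"
    and ne: "\<And>s. 0 \<le> s \<Longrightarrow> s < 1 \<Longrightarrow> \<exists>x. ennreal s < f x" "\<And>s. 0 \<le> s \<Longrightarrow> s < 1 \<Longrightarrow> \<exists>x. ennreal s < g x"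
    and sub: "\<And>s x y. 0 \<le> s \<Longrightarrow> s < 1 \<Longrightarrow> ennreal s < f x \<Longrightarrow> ennreal s < g y \<Longrightarrow> ennreal s < h ((1 - t) * x + t * y)"
  shows "ennreal (1 - t) * (\<integral>\<^sup>+x. f x \<partial>lborel) + ennreal t * (\<integral>\<^sup>+x. g x \<partial>lborel) \<le> (\<integral>\<^sup>+x. h x \<partial>lborel)"
proof -
  let ?m = "\<lambda>f s. indicator {0..} s * emeasure lborel {x::real. ennreal s < f x}"
  have meas[measurable]: "?m u \<in> borel_measurable borel" if [measurable]: "u \<in> borel_measurable borel" for u
    by measurable
  have "ennreal (1 - t) * ?m f s + ennreal t * ?m g s \<le> ?m h s" for s
  proof (cases "0 \<le> s \<and> s < 1")
    case True
    have "ennreal (1 - t) * emeasure lborel {x. ennreal s < f x} + ennreal t * emeasure lborel {x. ennreal s < g x}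
        \<le> emeasure lborel {x. ennreal s < h x}"
      by (rule brunn_minkowski_real) (use True t ne sub in auto)
    then show ?thesis
      using True by simp
  next
    case False
    then have "{x. ennreal s < u x} = {} \<or> s < 0" if "\<And>x. u x \<le> 1" for u :: "real \<Rightarrow> ennreal"
      using that by (force simp: not_less ennreal_1[symmetric] simp del: ennreal_1 intro: order_trans ennreal_leI)
    from this[of f] this[of g] le1 show ?thesis
      by (auto split: split_indicator)
  qed
  then have "(\<integral>\<^sup>+s. ennreal (1 - t) * ?m f s + ennreal t * ?m g s \<partial>lborel) \<le> (\<integral>\<^sup>+s. ?m h s \<partial>lborel)"
    by (intro nn_integral_mono)
  then show ?thesis
    by (simp add: nn_integral_add nn_integral_cmult nn_integral_layer_cake[symmetric])
qed

text \<open>Supplies the input of the normalized case. Truncation makes the supremum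
  \<open>A\<close> finite even for unbounded \<open>f\<close> and, by monotone convergence, keeps
  the integral above \<open>p\<close>; division by \<open>A\<close> does the rest.\<close>

lemma normalized_minorant:
  fixes f :: "real \<Rightarrow> ennreal"
  assumes [measurable]: "f \<in> borel_measurable borel" and p: "0 < p" "ennreal p < (\<integral>\<^sup>+x. f x \<partial>lborel)"
  obtains \<phi> A where "\<phi> \<in> borel_measurable borel" "0 < A" "\<forall>x. \<phi> x \<le> 1"
    "\<forall>s. 0 \<le> s \<longrightarrow> s < 1 \<longrightarrow> (\<exists>x. ennreal s < \<phi> x)" "\<forall>x. ennreal A * \<phi> x \<le> f x"
    "ennreal (p / A) < (\<integral>\<^sup>+x. \<phi> x \<partial>lborel)"
proof -
  have "(SUP n::nat. min (f x) (of_nat n)) = f x" for x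
    by (simp add: inf_min[symmetric] inf_SUP[symmetric] ennreal_SUP_of_nat_eq_top)
  then have "(\<integral>\<^sup>+x. f x \<partial>lborel) = (\<integral>\<^sup>+x. (SUP n::nat. min (f x) (of_nat n)) \<partial>lborel)"
    by simp
  also have "\<dots> = (SUP n::nat. \<integral>\<^sup>+x. min (f x) (of_nat n) \<partial>lborel)"
    by (intro nn_integral_monotone_convergence_SUP) (auto simp: incseq_def le_fun_def intro: min.coboundedI2)
  finally obtain n :: nat where n: "ennreal p < (\<integral>\<^sup>+x. min (f x) (of_nat n) \<partial>lborel)"
    using p by (auto simp: less_SUP_iff)
  define u where "u = (\<lambda>x. min (f x) (of_nat n))"
  have [measurable]: "u \<in> borel_measurable borel"
    unfolding u_def by simp
  define S where "S = (SUP x. u x)"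
  have uS: "u x \<le> S" for x
    unfolding S_def by (intro SUP_upper) auto
  have "S \<le> of_nat n"
    unfolding S_def u_def by (intro SUP_least) auto
  then have Sfin: "S < top"
    using of_nat_less_top order_le_less_trans by blast
  have "S \<noteq> 0"
  proof
    assume "S = 0"
    then have "u = (\<lambda>_. 0)"
      using uS by (auto simp: fun_eq_iff)
    then show False
      using n by (simp add: u_def[symmetric])
  qed
  obtain A where A: "S = ennreal A" "0 < A"
    using Sfin \<open>S \<noteq> 0\<close> by (cases S) (auto simp: less_le)
  define \<phi> where "\<phi> = (\<lambda>x. ennreal (1 / A) * u x)"
  have A\<phi>: "ennreal A * \<phi> x = u x" for x
    using A(2) by (simp add: \<phi>_def mult.assoc[symmetric] ennreal_mult[symmetric])
  show thesis
  proof
    show "\<phi> \<in> borel_measurable borel" "0 < A"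
      using A by (auto simp: \<phi>_def)
    show "\<forall>x. \<phi> x \<le> 1"
    proof
      fix x
      have "\<phi> x \<le> ennreal (1 / A) * ennreal A"
        unfolding \<phi>_def using uS[of x] A(1) by (intro mult_left_mono) auto
      then show "\<phi> x \<le> 1"
        using A(2) by (simp add: ennreal_mult[symmetric])
    qed
    show "\<forall>s. 0 \<le> s \<longrightarrow> s < 1 \<longrightarrow> (\<exists>x. ennreal s < \<phi> x)"
    proof (intro allI impI)
      fix s :: real assume s: "0 \<le> s" "s < 1"
      have "ennreal (s * A) < S"
        using s A by (simp add: ennreal_less_iff)
      then obtain x where x: "ennreal (s * A) < u x"
        by (auto simp: S_def less_SUP_iff)
      have "\<not> \<phi> x \<le> ennreal s"
      proof
        assume "\<phi> x \<le> ennreal s"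
        then have "ennreal A * \<phi> x \<le> ennreal A * ennreal s"
          by (intro mult_left_mono) auto
        then show False
          using x s A(2) by (simp add: A\<phi> ennreal_mult[symmetric] mult.commute)
      qed
      then show "\<exists>x. ennreal s < \<phi> x"
        by (auto simp: not_le)
    qed
    show "\<forall>x. ennreal A * \<phi> x \<le> f x"
      by (simp add: A\<phi> u_def)
    have eq: "ennreal A * (\<integral>\<^sup>+x. \<phi> x \<partial>lborel) = (\<integral>\<^sup>+x. u x \<partial>lborel)"
      unfolding A\<phi>[symmetric] by (subst nn_integral_cmult) (auto simp: \<phi>_def)
    show "ennreal (p / A) < (\<integral>\<^sup>+x. \<phi> x \<partial>lborel)"
    proof (rule ccontr)
      assume "\<not> ennreal (p / A) < (\<integral>\<^sup>+x. \<phi> x \<partial>lborel)"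
      then have "ennreal A * (\<integral>\<^sup>+x. \<phi> x \<partial>lborel) \<le> ennreal A * ennreal (p / A)"
        by (intro mult_left_mono) auto
      then show False
        using n A(2) p by (simp add: eq u_def[symmetric] ennreal_mult[symmetric])
    qed
  qed
qed

text \<open>\<open>a powr (1 - t) * b powr t \<le> c\<close> for extended nonnegative reals, where \<open>powr\<close> is not available.\<close>

definition geom_less :: "real \<Rightarrow> ennreal \<Rightarrow> ennreal \<Rightarrow> ennreal \<Rightarrow> bool" where
  "geom_less t a b c \<longleftrightarrow>
    (\<forall>p q. 0 < p \<longrightarrow> 0 < q \<longrightarrow> ennreal p < a \<longrightarrow> ennreal q < b \<longrightarrow> ennreal (p powr (1 - t) * q powr t) < c)"

lemma ennreal_less_between:
  assumes "ennreal p < a" "0 < p"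
  obtains r where "p < r" "ennreal r < a"
proof -
  obtain c where "ennreal p < c" "c < a"
    using dense[OF assms(1)] by blast
  then show thesis
    using assms(2) that by (cases c) (auto simp: ennreal_less_iff)
qed

text \<open>With \<open>c = A powr (1 - t) * B powr t\<close>, normalized minorants of
  \<open>f / A\<close> and \<open>g / B\<close> fit the normalized case with \<open>h / c\<close>.
  Its arithmetic mean dominates the geometric one by Young's inequality, and multiplying by
  \<open>c\<close> removes \<open>A\<close> and \<open>B\<close>.\<close>

lemma prekopa_leindler_real:
  fixes f g h :: "real \<Rightarrow> ennreal"
  assumes [measurable]: "f \<in> borel_measurable borel" "g \<in> borel_measurable borel" "h \<in> borel_measurable borel"
    and t: "0 < t" "t < 1"
    and geo: "\<And>x y. geom_less t (f x) (g y) (h ((1 - t) * x + t * y))"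
  shows "geom_less t (\<integral>\<^sup>+x. f x \<partial>lborel) (\<integral>\<^sup>+x. g x \<partial>lborel) (\<integral>\<^sup>+x. h x \<partial>lborel)"
  unfolding geom_less_def
proof (intro allI impI)
  fix p q :: real assume pq: "0 < p" "0 < q"
    and p: "ennreal p < (\<integral>\<^sup>+x. f x \<partial>lborel)" and q: "ennreal q < (\<integral>\<^sup>+x. g x \<partial>lborel)"
  \<comment> \<open>The layer argument ends in a weak inequality; the gap between \<open>p\<close>
    and \<open>p'\<close> makes it strict again.\<close>
  obtain p' where p': "p < p'" "ennreal p' < (\<integral>\<^sup>+x. f x \<partial>lborel)"
    by (rule ennreal_less_between[OF p pq(1)])
  obtain q' where q': "q < q'" "ennreal q' < (\<integral>\<^sup>+x. g x \<partial>lborel)"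
    by (rule ennreal_less_between[OF q pq(2)])
  have pq': "0 < p'" "0 < q'"
    using pq p'(1) q'(1) by auto
  obtain \<phi> A where \<phi>: "\<phi> \<in> borel_measurable borel" "0 < A" "\<forall>x. \<phi> x \<le> 1"
    "\<forall>s. 0 \<le> s \<longrightarrow> s < 1 \<longrightarrow> (\<exists>x. ennreal s < \<phi> x)" "\<forall>x. ennreal A * \<phi> x \<le> f x"
    "ennreal (p' / A) < (\<integral>\<^sup>+x. \<phi> x \<partial>lborel)"
    by (rule normalized_minorant[OF assms(1) pq'(1) p'(2)]) (rule that; assumption)
  obtain \<psi> B where \<psi>: "\<psi> \<in> borel_measurable borel" "0 < B" "\<forall>x. \<psi> x \<le> 1"
    "\<forall>s. 0 \<le> s \<longrightarrow> s < 1 \<longrightarrow> (\<exists>x. ennreal s < \<psi> x)" "\<forall>x. ennreal B * \<psi> x \<le> g x"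
    "ennreal (q' / B) < (\<integral>\<^sup>+x. \<psi> x \<partial>lborel)"
    by (rule normalized_minorant[OF assms(2) pq'(2) q'(2)]) (rule that; assumption)
  define c where "c = A powr (1 - t) * B powr t"
  have c: "0 < c"
    using \<phi>(2) \<psi>(2) by (simp add: c_def)
  define k where "k = (\<lambda>x. ennreal (1 / c) * h x)"
  have ck: "ennreal c * k x = h x" for x
    using c by (simp add: k_def mult.assoc[symmetric] ennreal_mult[symmetric])
  have scale: "ennreal (C * s) < v" if "ennreal s < w" "ennreal C * w \<le> v" "0 < C" "0 \<le> s" for C s v w
  proof -
    have "ennreal C * ennreal s < ennreal C * w"
      using that by (intro ennreal_mult_strict_left_mono) auto
    then show ?thesis
      using that by (simp add: ennreal_mult)
  qed
  have "ennreal (1 - t) * (\<integral>\<^sup>+x. \<phi> x \<partial>lborel) + ennreal t * (\<integral>\<^sup>+x. \<psi> x \<partial>lborel) \<le> (\<integral>\<^sup>+x. k x \<partial>lborel)"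
  proof (rule prekopa_leindler_real_normalized)
    fix s x y :: real assume s: "0 \<le> s" "s < 1" and xy: "ennreal s < \<phi> x" "ennreal s < \<psi> y"
    \<comment> \<open>\<open>s\<close> may be 0, whereas \<open>geom_less\<close> only speaks of
      positive levels; \<open>s'\<close> is positive.\<close>
    obtain s' where s': "s < s'" "ennreal s' < \<phi> x" "ennreal s' < \<psi> y"
    proof -
      obtain d where "ennreal s < d" "d < min (\<phi> x) (\<psi> y)"
        using dense[of "ennreal s" "min (\<phi> x) (\<psi> y)"] xy by auto
      then show thesis
        using s that by (cases d) (auto simp: ennreal_less_iff)
    qed
    have "ennreal (A * s') < f x" "ennreal (B * s') < g y"
      using scale[OF s'(2) \<phi>(5)[rule_format] \<phi>(2)] scale[OF s'(3) \<psi>(5)[rule_format] \<psi>(2)] s s' by auto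
    then have "ennreal ((A * s') powr (1 - t) * (B * s') powr t) < h ((1 - t) * x + t * y)"
      using geo[of x y] \<phi>(2) \<psi>(2) s s'(1) by (auto simp: geom_less_def)
    also have "(A * s') powr (1 - t) * (B * s') powr t = c * (s' powr (1 - t) * s' powr t)"
      using \<phi>(2) \<psi>(2) s s'(1) by (simp add: c_def powr_mult)
    also have "\<dots> = c * s'"
      using s s'(1) by (simp add: powr_add[symmetric])
    finally have "ennreal (1 / c * (c * s')) < k ((1 - t) * x + t * y)"
      using c s s'(1)
      by (intro scale[where w = "h ((1 - t) * x + t * y)" and C = "1 / c" and s = "c * s'"])
         (auto simp: k_def)
    then have "ennreal s' < k ((1 - t) * x + t * y)"
      using c by simp
    moreover have "ennreal s \<le> ennreal s'"
      using s'(1) by (intro ennreal_leI) auto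
    ultimately show "ennreal s < k ((1 - t) * x + t * y)"
      by (rule order_le_less_trans[rotated])
  qed (use \<phi> \<psi> t in \<open>auto simp: k_def\<close>)
  moreover have "ennreal ((1 - t) * (p' / A) + t * (q' / B))
      \<le> ennreal (1 - t) * (\<integral>\<^sup>+x. \<phi> x \<partial>lborel) + ennreal t * (\<integral>\<^sup>+x. \<psi> x \<partial>lborel)"
  proof -
    have "ennreal ((1 - t) * (p' / A) + t * (q' / B)) = ennreal (1 - t) * ennreal (p' / A) + ennreal t * ennreal (q' / B)"
      using t pq p' q' \<phi>(2) \<psi>(2) by (simp add: ennreal_mult[symmetric])
    also have "\<dots> \<le> ennreal (1 - t) * (\<integral>\<^sup>+x. \<phi> x \<partial>lborel) + ennreal t * (\<integral>\<^sup>+x. \<psi> x \<partial>lborel)"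
      using \<phi>(6) \<psi>(6) by (intro add_mono mult_left_mono) auto
    finally show ?thesis .
  qed
  moreover have "(p' / A) powr (1 - t) * (q' / B) powr t \<le> (1 - t) * (p' / A) + t * (q' / B)"
    using t pq p' q' \<phi>(2) \<psi>(2) by (intro Youngs_inequality_0) auto
  ultimately have "ennreal ((p' / A) powr (1 - t) * (q' / B) powr t) \<le> (\<integral>\<^sup>+x. k x \<partial>lborel)"
    by (meson ennreal_leI order_trans)
  then have "ennreal c * ennreal ((p' / A) powr (1 - t) * (q' / B) powr t) \<le> ennreal c * (\<integral>\<^sup>+x. k x \<partial>lborel)"
    by (intro mult_left_mono) auto
  also have "ennreal c * (\<integral>\<^sup>+x. k x \<partial>lborel) = (\<integral>\<^sup>+x. h x \<partial>lborel)"
    unfolding ck[symmetric] by (subst nn_integral_cmult) (auto simp: k_def)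
  also have "ennreal c * ennreal ((p' / A) powr (1 - t) * (q' / B) powr t) = ennreal (p' powr (1 - t) * q' powr t)"
    using c \<phi>(2) \<psi>(2) pq p' q' by (simp add: ennreal_mult[symmetric] c_def powr_divide)
  finally have le: "ennreal (p' powr (1 - t) * q' powr t) \<le> (\<integral>\<^sup>+x. h x \<partial>lborel)" .
  have "p powr (1 - t) * q powr t < p' powr (1 - t) * q' powr t"
    using pq p' q' t by (intro mult_strict_mono powr_less_mono2) auto
  then have "ennreal (p powr (1 - t) * q powr t) < ennreal (p' powr (1 - t) * q' powr t)"
    by (intro ennreal_lessI) (use pq p' q' in auto)
  also note le
  finally show "ennreal (p powr (1 - t) * q powr t) < (\<integral>\<^sup>+x. h x \<partial>lborel)" .
qed

text \<open>Induction over coordinates: by the induction hypothesis the slice integrals at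
  \<open>y\<close>, \<open>z\<close> and \<open>(1 - t) * y + t * z\<close> satisfy the hypothesis
  of the one-dimensional case. They may be infinite, which \<open>geom_less\<close> permits.\<close>

lemma prekopa_leindler_PiM:
  fixes f g h :: "('i \<Rightarrow> real) \<Rightarrow> ennreal"
  assumes "finite I" and t: "0 < t" "t < 1"
    and "f \<in> borel_measurable (\<Pi>\<^sub>M i\<in>I. lborel)" "g \<in> borel_measurable (\<Pi>\<^sub>M i\<in>I. lborel)"
      "h \<in> borel_measurable (\<Pi>\<^sub>M i\<in>I. lborel)"
    and "\<And>x y. geom_less t (f x) (g y) (h (\<lambda>i. (1 - t) * x i + t * y i))"
  shows "geom_less t (\<integral>\<^sup>+x. f x \<partial>(\<Pi>\<^sub>M i\<in>I. lborel)) (\<integral>\<^sup>+x. g x \<partial>(\<Pi>\<^sub>M i\<in>I. lborel)) (\<integral>\<^sup>+x. h x \<partial>(\<Pi>\<^sub>M i\<in>I. lborel))"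
  using assms(1,4-)
proof (induction I arbitrary: f g h rule: finite_induct)
  case empty
  \<comment> \<open>The only point of the empty product is constantly \<open>undefined\<close>, and
    it is its own convex combination.\<close>
  have "(\<lambda>i. (1 - t) * undefined + t * undefined) = (\<lambda>i::'i. undefined :: real)"
    by (simp add: algebra_simps)
  then show ?case
    using empty(4)[of "\<lambda>_. undefined" "\<lambda>_. undefined"]
    by (simp add: PiM_empty nn_integral_count_space_finite)
next
  case (insert i I)
  interpret product_sigma_finite "\<lambda>_::'i. lborel :: real measure" ..
  interpret I: finite_product_sigma_finite "\<lambda>_::'i. lborel :: real measure" I
    by standard (rule insert.hyps)
  note [measurable] = insert.prems(1-3)
  have slice: "geom_less t (\<integral>\<^sup>+x. f (x(i := y)) \<partial>(\<Pi>\<^sub>M i\<in>I. lborel)) (\<integral>\<^sup>+x. g (x(i := z)) \<partial>(\<Pi>\<^sub>M i\<in>I. lborel))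
      (\<integral>\<^sup>+x. h (x(i := (1 - t) * y + t * z)) \<partial>(\<Pi>\<^sub>M i\<in>I. lborel))" for y z
  proof (rule insert.IH)
    fix x x' :: "'i \<Rightarrow> real"
    have "(\<lambda>j. (1 - t) * (x(i := y)) j + t * (x'(i := z)) j)
        = (\<lambda>j. (1 - t) * x j + t * x' j)(i := (1 - t) * y + t * z)"
      by auto
    then show "geom_less t (f (x(i := y))) (g (x'(i := z))) (h ((\<lambda>j. (1 - t) * x j + t * x' j)(i := (1 - t) * y + t * z)))"
      using insert.prems(4)[of "x(i := y)" "x'(i := z)"] by (simp only:)
  qed measurable
  show ?case
    unfolding product_nn_integral_insert_rev[OF insert.hyps(1,2) insert.prems(1)]
      product_nn_integral_insert_rev[OF insert.hyps(1,2) insert.prems(2)]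
      product_nn_integral_insert_rev[OF insert.hyps(1,2) insert.prems(3)]
  proof (rule prekopa_leindler_real[OF _ _ _ t])
    show "geom_less t (\<integral>\<^sup>+x. f (x(i := y)) \<partial>(\<Pi>\<^sub>M i\<in>I. lborel)) (\<integral>\<^sup>+x. g (x(i := z)) \<partial>(\<Pi>\<^sub>M i\<in>I. lborel))
        (\<integral>\<^sup>+x. h (x(i := (1 - t) * y + t * z)) \<partial>(\<Pi>\<^sub>M i\<in>I. lborel))" for y z
      by (rule slice)
  qed measurable
qed

theorem prekopa_leindler:
  fixes f g h :: "'a::euclidean_space \<Rightarrow> ennreal"
  assumes t: "0 < t" "t < 1"
    and [measurable]: "f \<in> borel_measurable borel" "g \<in> borel_measurable borel" "h \<in> borel_measurable borel"
    and geo: "\<And>x y. geom_less t (f x) (g y) (h ((1 - t) *\<^sub>R x + t *\<^sub>R y))"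
  shows "geom_less t (\<integral>\<^sup>+x. f x \<partial>lborel) (\<integral>\<^sup>+x. g x \<partial>lborel) (\<integral>\<^sup>+x. h x \<partial>lborel)"
proof -
  let ?T = "\<lambda>x::'a \<Rightarrow> real. \<Sum>b\<in>Basis. x b *\<^sub>R b"
  have T: "(\<integral>\<^sup>+x. u x \<partial>lborel) = (\<integral>\<^sup>+x. u (?T x) \<partial>(\<Pi>\<^sub>M b\<in>Basis. lborel))"
    if [measurable]: "u \<in> borel_measurable borel" for u :: "'a \<Rightarrow> ennreal"
    by (subst lborel_eq, subst nn_integral_distr) measurable
  have lin: "?T (\<lambda>b. (1 - t) * x b + t * y b) = (1 - t) *\<^sub>R ?T x + t *\<^sub>R ?T y" for x y
    by (simp add: scaleR_left_distrib sum.distrib scaleR_sum_right)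
  show ?thesis
    unfolding T[OF assms(3)] T[OF assms(4)] T[OF assms(5)]
  proof (rule prekopa_leindler_PiM[OF finite_Basis t])
    show "geom_less t (f (?T x)) (g (?T y)) (h (?T (\<lambda>b. (1 - t) * x b + t * y b)))" for x y
      unfolding lin by (rule geo)
  qed measurable
qed

subsection \<open>Integrable log-concave functions\<close>

text \<open>Comparison with a sum over unit shells: on the shell
  \<open>k \<le> norm x < k + 1\<close> the function is at most \<open>exp (- a k)\<close>, and the
  polynomial volume of the ball of radius \<open>k + 1\<close> costs only half of the exponential
  rate.\<close>

lemma integrable_exp_minus_norm:
  fixes a :: real
  assumes a: "0 < a"
  shows "integrable lborel (\<lambda>x::'a::euclidean_space. exp (- (a * norm x)))"
proof -
  let ?n = "DIM('a)" and ?v = "measure lborel (ball (0::'a) 1)"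
  \<comment> \<open>Chosen so that \<open>k + 1 \<le> D * (1 + a * k / (2 * n))\<close> for the
    dimension \<open>n\<close>; the \<open>n\<close>-th power of this bound is at most
    \<open>D ^ n * exp (a * k / 2)\<close>.\<close>
  define D where "D = max 1 (2 * ?n / a)"
  have D: "1 \<le> D" "2 * ?n / a \<le> D"
    by (auto simp: D_def)
  have poly: "(real k + 1) ^ ?n \<le> D ^ ?n * exp (a * k / 2)" for k :: nat
  proof -
    have "real k = (2 * ?n / a) * (a * k / (2 * ?n))"
      using a by simp
    also have "\<dots> \<le> D * (a * k / (2 * ?n))"
      using D a by (intro mult_right_mono) auto
    finally have "real k + 1 \<le> D * (1 + a * k / (2 * ?n))"
      using D(1) by (simp add: distrib_left)
    also have "\<dots> \<le> D * exp (a * k / (2 * ?n))"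
      using D(1) by (intro mult_left_mono) auto
    finally have "(real k + 1) ^ ?n \<le> (D * exp (a * k / (2 * ?n))) ^ ?n"
      by (intro power_mono) auto
    also have "\<dots> = D ^ ?n * exp (a * k / 2)"
      by (simp add: power_mult_distrib exp_of_nat_mult[symmetric])
    finally show ?thesis .
  qed
  have sm: "summable (\<lambda>k. exp (- (a * real k)) * ((real k + 1) ^ ?n * ?v))"
  proof (rule summable_comparison_test')
    have "summable (\<lambda>k. exp (- a / 2) ^ k)"
      using a by (intro summable_geometric) simp
    then show "summable (\<lambda>k. D ^ ?n * ?v * exp (- a / 2) ^ k)"
      by (rule summable_mult)
    show "norm (exp (- (a * real k)) * ((real k + 1) ^ ?n * ?v)) \<le> D ^ ?n * ?v * exp (- a / 2) ^ k"
      if "0 \<le> k" for k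
    proof -
      have "exp (- (a * real k)) * ((real k + 1) ^ ?n * ?v) \<le> exp (- (a * real k)) * ((D ^ ?n * exp (a * k / 2)) * ?v)"
        using poly by (intro mult_left_mono mult_right_mono) auto
      also have "\<dots> = D ^ ?n * ?v * (exp (- (a * real k)) * exp (a * k / 2))"
        by simp
      also have "exp (- (a * real k)) * exp (a * k / 2) = exp (- a / 2) ^ k"
        by (simp add: exp_of_nat_mult[symmetric] exp_add[symmetric] field_simps)
      finally show ?thesis
        by simp
    qed
  qed
  have [measurable]: "ball (0::'a) r \<in> sets borel" for r
    by simp
  have term_le: "F k \<le> suminf F" for F :: "nat \<Rightarrow> ennreal" and k
    using sum_le_suminf[OF summableI, of "{k}" F] by simp
  have "(\<integral>\<^sup>+x. ennreal (exp (- (a * norm (x::'a)))) \<partial>lborel)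
      \<le> (\<integral>\<^sup>+x. (\<Sum>k. ennreal (exp (- (a * real k))) * indicator (ball (0::'a) (real k + 1)) x) \<partial>lborel)"
  proof (rule nn_integral_mono)
    fix x :: 'a
    define k where "k = nat \<lfloor>norm x\<rfloor>"
    have k: "real k \<le> norm x" "norm x < real k + 1"
      by (simp_all add: k_def)
    have "ennreal (exp (- (a * norm x))) \<le> ennreal (exp (- (a * real k))) * indicator (ball (0::'a) (real k + 1)) x"
      using k a by (auto intro!: ennreal_leI)
    also have "\<dots> \<le> (\<Sum>k. ennreal (exp (- (a * real k))) * indicator (ball (0::'a) (real k + 1)) x)"
      by (rule term_le)
    finally show "ennreal (exp (- (a * norm x)))
        \<le> (\<Sum>k. ennreal (exp (- (a * real k))) * indicator (ball (0::'a) (real k + 1)) x)" .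
  qed
  also have "\<dots> = (\<Sum>k. \<integral>\<^sup>+x. ennreal (exp (- (a * real k))) * indicator (ball (0::'a) (real k + 1)) x \<partial>lborel)"
    by (intro nn_integral_suminf) measurable
  also have "\<dots> = (\<Sum>k. ennreal (exp (- (a * real k)) * ((real k + 1) ^ ?n * ?v)))"
  proof (intro suminf_cong)
    fix k :: nat
    have "emeasure lborel (ball (0::'a) (real k + 1)) = ennreal ((real k + 1) ^ ?n * ?v)"
      using content_ball_conv_unit_ball[of "real k + 1" "0::'a"]
        emeasure_lborel_ball_finite[of "0::'a" "real k + 1"]
      by (simp add: emeasure_eq_ennreal_measure less_top)
    then show "(\<integral>\<^sup>+x. ennreal (exp (- (a * real k))) * indicator (ball (0::'a) (real k + 1)) x \<partial>lborel)
        = ennreal (exp (- (a * real k)) * ((real k + 1) ^ ?n * ?v))"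
      by (subst nn_integral_cmult_indicator) (auto simp: ennreal_mult)
  qed
  also have "\<dots> < top"
    unfolding less_top[symmetric] by (rule ennreal_suminf_neq_top[OF sm]) simp
  finally show ?thesis
    by (intro integrableI_nonneg) auto
qed

text \<open>Log-concavity without the potential \<open>v\<close>: since \<open>0 powr s = 0\<close>,
  the value 0 takes over the role of \<open>v x = \<infinity>\<close>, and products and suprema can
  be treated without case splits on infinity.\<close>

definition geom_concave :: "('a::real_vector \<Rightarrow> real) \<Rightarrow> bool" where
  "geom_concave f \<longleftrightarrow> (\<forall>x. 0 \<le> f x) \<and>
    (\<forall>x y t. 0 < t \<longrightarrow> t < 1 \<longrightarrow> f x powr (1 - t) * f y powr t \<le> f ((1 - t) *\<^sub>R x + t *\<^sub>R y))"

lemma geom_concave_nonneg: "geom_concave f \<Longrightarrow> 0 \<le> f x"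
  and geom_concaveD: "geom_concave f \<Longrightarrow> 0 < t \<Longrightarrow> t < 1 \<Longrightarrow>
    f x powr (1 - t) * f y powr t \<le> f ((1 - t) *\<^sub>R x + t *\<^sub>R y)"
  by (auto simp: geom_concave_def)

lemma log_concave_imp_geom_concave:
  assumes "log_concave f"
  shows "geom_concave f"
proof -
  obtain v where v: "ext_convex v" and f: "\<And>x. f x = (if v x = \<infinity> then 0 else exp (- real_of_ereal (v x)))"
    using assms by (auto simp: log_concave_def)
  have "f x powr (1 - t) * f y powr t \<le> f ((1 - t) *\<^sub>R x + t *\<^sub>R y)" if t: "0 < t" "t < 1" for x y t
  proof (cases "v x = \<infinity> \<or> v y = \<infinity>")
    case True
    then show ?thesis
      by (auto simp: f)
  next
    case False
    let ?z = "(1 - t) *\<^sub>R x + t *\<^sub>R y"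
    have ninf: "v w \<noteq> -\<infinity>" for w
      using v by (simp add: ext_convex_def)
    obtain a b where ab: "v x = ereal a" "v y = ereal b"
      using False ninf[of x] ninf[of y] by (cases "v x"; cases "v y") auto
    have "v ?z \<le> ereal ((1 - t) * a + t * b)"
      using v[unfolded ext_convex_def, THEN conjunct2, rule_format, of t x y] t ab by simp
    moreover from this obtain c where c: "v ?z = ereal c"
      using ninf[of ?z] by (cases "v ?z") auto
    ultimately have "c \<le> (1 - t) * a + t * b"
      by simp
    then have "exp (- ((1 - t) * a + t * b)) \<le> exp (- c)"
      by simp
    moreover have "exp (- a) powr (1 - t) * exp (- b) powr t = exp (- ((1 - t) * a + t * b))"
      by (simp add: powr_def exp_add[symmetric] algebra_simps)
    moreover have "f x = exp (- a)" "f y = exp (- b)" "f ?z = exp (- c)"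
      by (simp_all add: f ab c)
    ultimately show ?thesis
      by simp
  qed
  then show ?thesis
    by (auto simp: geom_concave_def f)
qed

lemma geom_concave_convex_support:
  assumes "geom_concave f"
  shows "convex {x. 0 < f x}"
  unfolding convex_alt
proof (intro ballI allI impI)
  fix x y and t :: real assume xy: "x \<in> {x. 0 < f x}" "y \<in> {x. 0 < f x}" and "0 \<le> t \<and> t \<le> 1"
  then consider "t = 0" | "t = 1" | "0 < t" "t < 1"
    by linarith
  then show "(1 - t) *\<^sub>R x + t *\<^sub>R y \<in> {x. 0 < f x}"
  proof cases
    case 3
    have "0 < f x powr (1 - t) * f y powr t"
      using xy by simp
    also note geom_concaveD[OF assms 3]
    finally show ?thesis
      by simp
  qed (use xy in auto)
qed

lemma geom_concave_convex_on_minus_ln: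
  assumes "geom_concave f"
  shows "convex_on {x. 0 < f x} (\<lambda>x. - ln (f x))"
proof
  fix t :: real and x y assume t: "0 < t" "t < 1" and xy: "x \<in> {x. 0 < f x}" "y \<in> {x. 0 < f x}"
  have "(1 - t) * ln (f x) + t * ln (f y) = ln (f x powr (1 - t) * f y powr t)"
    using xy by (simp add: ln_mult ln_powr)
  also have "\<dots> \<le> ln (f ((1 - t) *\<^sub>R x + t *\<^sub>R y))"
    using xy by (intro ln_mono geom_concaveD[OF assms t]) auto
  finally show "- ln (f ((1 - t) *\<^sub>R x + t *\<^sub>R y)) \<le> (1 - t) * - ln (f x) + t * - ln (f y)"
    by simp
qed (rule geom_concave_convex_support[OF assms])

lemma geom_concave_continuous_on_interior:
  fixes f :: "'a::euclidean_space \<Rightarrow> real"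
  assumes "geom_concave f"
  shows "continuous_on (interior {x. 0 < f x}) f"
proof -
  have "continuous_on (interior {x. 0 < f x}) (\<lambda>x. - ln (f x))"
    by (intro convex_on_continuous open_interior convex_on_subset[OF geom_concave_convex_on_minus_ln[OF assms]]
        interior_subset convex_interior geom_concave_convex_support[OF assms])
  then have "continuous_on (interior {x. 0 < f x}) (\<lambda>x. exp (- (- ln (f x))))"
    by (rule continuous_on_exp[OF continuous_on_minus])
  then show ?thesis
    by (rule continuous_on_eq) (use interior_subset[of "{x. 0 < f x}"] in auto)
qed

section \<open>Borel representatives of log-concave functions\<close>

definition open_part :: "('a::euclidean_space \<Rightarrow> real) \<Rightarrow> 'a \<Rightarrow> real" where
  "open_part f x = indicator (interior {x. 0 < f x}) x * f x"

lemma open_part_eq: "x \<in> interior {x. 0 < f x} \<Longrightarrow> open_part f x = f x"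
  and open_part_eq_0: "x \<notin> interior {x. 0 < f x} \<Longrightarrow> open_part f x = 0"
  by (auto simp: open_part_def)

lemma open_part_pos_iff: "0 < open_part f x \<longleftrightarrow> x \<in> interior {x. 0 < f x}"
  using interior_subset[of "{x. 0 < f x}"] by (auto simp: open_part_def indicator_def)

lemma open_part_le: "geom_concave f \<Longrightarrow> open_part f x \<le> f x"
  by (auto simp: open_part_def indicator_def geom_concave_nonneg)

lemma borel_measurable_open_part [measurable]:
  "geom_concave f \<Longrightarrow> open_part f \<in> borel_measurable borel"
  using borel_measurable_continuous_on_indicator[OF _ geom_concave_continuous_on_interior, of f]
  by (simp add: open_part_def[abs_def])

lemma geom_concave_open_part:
  assumes "geom_concave f"
  shows "geom_concave (open_part f)"
  unfolding geom_concave_def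
proof (intro conjI allI impI)
  show "0 \<le> open_part f x" for x
    using geom_concave_nonneg[OF assms] by (simp add: open_part_def)
  fix x y :: 'a and t :: real assume t: "0 < t" "t < 1"
  let ?U = "interior {x. 0 < f x}"
  show "open_part f x powr (1 - t) * open_part f y powr t \<le> open_part f ((1 - t) *\<^sub>R x + t *\<^sub>R y)"
  proof (cases "x \<in> ?U \<and> y \<in> ?U")
    case True
    then have "(1 - t) *\<^sub>R x + t *\<^sub>R y \<in> ?U"
      using t geom_concave_convex_support[OF assms] by (intro convexD_alt) auto
    then show ?thesis
      using True t by (simp add: open_part_eq geom_concaveD[OF assms])
  next
    case False
    then show ?thesis
      using \<open>\<And>x. 0 \<le> open_part f x\<close> by (auto simp: open_part_eq_0)
  qed
qed

text \<open>The two functions can differ only on the frontier of the support, which is negligible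
  because the support is convex.\<close>

lemma AE_open_part:
  assumes "geom_concave f"
  shows "AE x in lebesgue. f x = open_part f x"
proof (rule AE_I')
  show "frontier {x. 0 < f x} \<in> null_sets lebesgue"
    using negligible_convex_frontier[OF geom_concave_convex_support[OF assms]]
    by (simp add: negligible_iff_null_sets)
  show "{x \<in> space lebesgue. f x \<noteq> open_part f x} \<subseteq> frontier {x. 0 < f x}"
  proof
    fix x assume "x \<in> {x \<in> space lebesgue. f x \<noteq> open_part f x}"
    then have "x \<notin> interior {x. 0 < f x}" "f x \<noteq> 0"
      by (auto simp: open_part_def)
    moreover from this have "x \<in> {x. 0 < f x}"
      using geom_concave_nonneg[OF assms, of x] by auto
    then have "x \<in> closure {x. 0 < f x}"
      by (rule subsetD[OF closure_subset])
    ultimately show "x \<in> frontier {x. 0 < f x}"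
      by (simp add: frontier_def)
  qed
qed

lemma
  fixes F G :: "'a::euclidean_space \<Rightarrow> 'b::euclidean_space"
  assumes ae: "AE x in lebesgue. F x = G x" and G [measurable]: "G \<in> borel_measurable borel"
  shows integrable_lebesgue_AE_borel: "integrable lebesgue F \<longleftrightarrow> integrable lborel G"
    and integral_lebesgue_AE_borel: "(LINT x|lebesgue. F x) = (LINT x|lborel. G x)"
proof -
  have G': "G \<in> borel_measurable lebesgue"
    using G by (simp add: measurable_completion)
  have F: "F \<in> borel_measurable lebesgue"
    using ae by (intro borel_measurable_AE[OF G']) auto
  have "integrable lebesgue F \<longleftrightarrow> integrable lebesgue G"
    using ae F G' by (intro integrable_cong_AE) auto
  also have "\<dots> \<longleftrightarrow> integrable lborel G"
    using G by (intro integrable_completion) auto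
  finally show "integrable lebesgue F \<longleftrightarrow> integrable lborel G" .
  have "(LINT x|lebesgue. F x) = (LINT x|lebesgue. G x)"
    using ae F G' by (intro integral_cong_AE) auto
  also have "\<dots> = (LINT x|lborel. G x)"
    using G by (intro integral_completion) auto
  finally show "(LINT x|lebesgue. F x) = (LINT x|lborel. G x)" .
qed

text \<open>The midpoints of \<open>x\<close> with a ball on which \<open>f\<close> is bounded below fill a ball on which
  \<open>f\<close> is at least a multiple of \<open>sqrt (f x)\<close>.\<close>

lemma geom_concave_sqrt_le_integral:
  fixes f :: "'a::euclidean_space \<Rightarrow> real"
  assumes f: "geom_concave f" and int: "integrable lebesgue f" and pos: "0 < (LINT x|lebesgue. f x)"
  obtains \<kappa> r x0 where "0 < \<kappa>" "0 < r"
    "\<And>x. \<kappa> * sqrt (f x) \<le> (LINT y|lebesgue. indicator (ball ((1/2) *\<^sub>R (x0 + x)) r) y * f y)"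
proof -
  let ?U = "interior {x. 0 < f x}"
  have "?U \<noteq> {}"
  proof
    assume "?U = {}"
    then have "AE x in lebesgue. f x = 0"
      using AE_open_part[OF f] by (simp add: open_part_def)
    then have "(LINT x|lebesgue. f x) = (LINT x|lebesgue. (\<lambda>_::'a. 0) x)"
      using int by (intro integral_cong_AE) auto
    then show False
      using pos by simp
  qed
  then obtain x0 where x0: "x0 \<in> ?U"
    by blast
  then have fx0: "0 < f x0"
    using interior_subset by blast
  have "isCont f x0"
    using geom_concave_continuous_on_interior[OF f] x0 by (simp add: continuous_on_eq_continuous_at)
  then have "\<forall>e>0. \<exists>d>0. \<forall>w. dist w x0 < d \<longrightarrow> dist (f w) (f x0) < e"
    by (simp add: continuous_at_eps_delta)
  from this[rule_format, of "f x0 / 2"] obtain d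
    where d: "0 < d" "\<And>w. dist w x0 < d \<Longrightarrow> dist (f w) (f x0) < f x0 / 2"
    using fx0 by auto
  have low: "f x0 / 2 \<le> f w" if "w \<in> ball x0 d" for w
    using d(2)[of w] that by (auto simp: dist_commute dist_real_def abs_real_def split: if_splits)
  define c where "c = f x0 / 2"
  have c: "0 < c"
    using fx0 by (simp add: c_def)
  define r where "r = d / 2"
  have r: "0 < r"
    using d by (simp add: r_def)
  define \<kappa> where "\<kappa> = sqrt c * measure lborel (ball (0::'a) r)"
  have "\<kappa> * sqrt (f x) \<le> (LINT y|lebesgue. indicator (ball ((1/2) *\<^sub>R (x0 + x)) r) y * f y)" for x
  proof -
    let ?B = "ball ((1/2) *\<^sub>R (x0 + x)) r"
    have B: "sqrt c * sqrt (f x) \<le> f y" if "y \<in> ?B" for y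
    proof -
      \<comment> \<open>\<open>y\<close> is the midpoint of \<open>w\<close> and \<open>x\<close>;
        the doubling of distances from \<open>y\<close> to \<open>w\<close> is the reason for
        \<open>r = d / 2\<close>.\<close>
      define w where "w = 2 *\<^sub>R y - x"
      have "x0 - w = 2 *\<^sub>R ((1/2) *\<^sub>R (x0 + x) - y)"
        by (simp add: w_def algebra_simps)
      then have "norm (x0 - w) = 2 * norm ((1/2) *\<^sub>R (x0 + x) - y)"
        by (metis abs_numeral norm_scaleR)
      then have "w \<in> ball x0 d"
        using that by (simp add: dist_norm r_def)
      then have "c powr (1 - 1/2) * f x powr (1/2) \<le> f w powr (1 - 1/2) * f x powr (1/2)"
        using low[of w] c by (intro mult_right_mono powr_mono2) (auto simp: c_def)
      also have "\<dots> \<le> f ((1 - 1/2) *\<^sub>R w + (1/2) *\<^sub>R x)"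
        by (intro geom_concaveD[OF f]) auto
      also have "(1 - 1/2) *\<^sub>R w + (1/2) *\<^sub>R x = y"
        by (simp add: w_def algebra_simps)
      finally show ?thesis
        using c geom_concave_nonneg[OF f, of x] by (simp add: powr_half_sqrt)
    qed
    have cb: "measure lborel ?B = measure lborel (ball (0::'a) r)"
      using content_ball_conv_unit_ball[of r "0::'a"] content_ball_conv_unit_ball[of r "(1/2) *\<^sub>R (x0 + x)"] r
      by simp
    have "\<kappa> * sqrt (f x) = (LINT y|lebesgue. indicator ?B y * (sqrt c * sqrt (f x)))"
      by (simp add: \<kappa>_def cb)
    also have "\<dots> \<le> (LINT y|lebesgue. indicator ?B y * f y)"
    proof (rule integral_mono)
      show "integrable lebesgue (\<lambda>y. indicator ?B y * (sqrt c * sqrt (f x)))"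
        using emeasure_lborel_ball_finite[of "(1/2) *\<^sub>R (x0 + x)" r]
        by (intro integrable_mult_left integrable_real_indicator) auto
      show "integrable lebesgue (\<lambda>y. indicator ?B y * f y)"
        using integrable_mult_indicator[OF _ int, of ?B] by simp
    qed (use B in \<open>auto split: split_indicator\<close>)
    finally show ?thesis .
  qed
  moreover have "0 < \<kappa>"
    using c r content_ball_pos[of r "0::'a"] by (simp add: \<kappa>_def)
  ultimately show thesis
    using that r by blast
qed

text \<open>A real \<open>SUP\<close> dominates the values only of a function that is bounded above,
  so this is what turns \<open>sup_norm f = f 0\<close> into a maximum at the origin.\<close>

lemma geom_concave_integrable_bounded:
  fixes f :: "'a::euclidean_space \<Rightarrow> real"
  assumes f: "geom_concave f" and int: "integrable lebesgue f" and pos: "0 < (LINT x|lebesgue. f x)"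
  shows "bdd_above (range f)"
proof -
  obtain \<kappa> r x0 where \<kappa>: "0 < \<kappa>" "0 < r"
    "\<And>x. \<kappa> * sqrt (f x) \<le> (LINT y|lebesgue. indicator (ball ((1/2) *\<^sub>R (x0 + x)) r) y * f y)"
    using geom_concave_sqrt_le_integral[OF assms] by blast
  show ?thesis
  proof (rule bdd_aboveI2)
    fix x
    have "(LINT y|lebesgue. indicator (ball ((1/2) *\<^sub>R (x0 + x)) r) y * f y) \<le> (LINT y|lebesgue. f y)"
    proof (rule integral_mono)
      show "integrable lebesgue (\<lambda>y. indicator (ball ((1/2) *\<^sub>R (x0 + x)) r) y * f y)"
        using integrable_mult_indicator[OF _ int, of "ball ((1/2) *\<^sub>R (x0 + x)) r"] by simp
    qed (use int geom_concave_nonneg[OF f] in \<open>auto split: split_indicator\<close>)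
    then have "sqrt (f x) \<le> (LINT y|lebesgue. f y) / \<kappa>"
      using \<kappa>(1) \<kappa>(3)[of x] by (simp add: field_simps)
    then show "f x \<le> ((LINT y|lebesgue. f y) / \<kappa>)\<^sup>2"
      by (rule sqrt_le_D)
  qed
qed


text \<open>The mass of \<open>f\<close> outside large balls tends to 0, so \<open>f\<close> drops
  to \<open>f 0 * exp (-1)\<close> at some distance \<open>R\<close>. Log-concavity along rays from
  the maximum at 0 then forces a drop by the factor \<open>exp (- norm x / R)\<close> beyond
  it.\<close>

lemma geom_concave_exp_decay:
  fixes f :: "'a::euclidean_space \<Rightarrow> real"
  assumes f: "geom_concave f" and int: "integrable lebesgue f" and pos: "0 < (LINT x|lebesgue. f x)"
    and max: "\<And>x. f x \<le> f 0"
  obtains C a where "0 < a" "\<And>x. f x \<le> C * exp (- (a * norm x))"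
proof -
  note nonneg = geom_concave_nonneg[OF f]
  have f0: "0 < f 0"
  proof (rule ccontr)
    assume "\<not> 0 < f 0"
    then have "f = (\<lambda>_. 0)"
      using max nonneg by (force simp: fun_eq_iff intro: antisym order_trans)
    then show False
      using pos by simp
  qed
  obtain \<kappa> r x0 where \<kappa>: "0 < \<kappa>" "0 < r"
    "\<And>x. \<kappa> * sqrt (f x) \<le> (LINT y|lebesgue. indicator (ball ((1/2) *\<^sub>R (x0 + x)) r) y * f y)"
    using geom_concave_sqrt_le_integral[OF f int pos] by blast
  define T where "T n = (LINT y|lebesgue. indicator {y. real n \<le> norm y} y * f y)" for n
  have closed: "{y::'a. c \<le> norm y} \<in> sets borel" for c
    by (intro borel_closed closed_Collect_le continuous_intros)
  have intT: "integrable lebesgue (\<lambda>y. indicator {y. real n \<le> norm y} y * f y)" for n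
    using integrable_mult_indicator[OF _ int, of "{y. real n \<le> norm y}"] closed by simp
  have "T \<longlonglongrightarrow> (LINT y|lebesgue. (\<lambda>_::'a. 0) y)"
    unfolding T_def
  proof (rule integral_dominated_convergence[OF _ _ int])
    show "AE y in lebesgue. (\<lambda>n. indicator {y. real n \<le> norm y} y * f y) \<longlonglongrightarrow> 0"
    proof (intro AE_I2 tendsto_eventually)
      fix y :: 'a
      obtain N :: nat where "norm y < real N"
        using reals_Archimedean2 by blast
      then show "\<forall>\<^sub>F n in sequentially. indicator {y. real n \<le> norm y} y * f y = 0"
        by (intro eventually_sequentiallyI[of N]) (auto split: split_indicator)
    qed
    show "\<And>n. (\<lambda>y. indicator {y. real n \<le> norm y} y * f y) \<in> borel_measurable lebesgue"
      using intT by auto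
  qed (use nonneg in \<open>auto split: split_indicator\<close>)
  then have "T \<longlonglongrightarrow> 0"
    by simp
  then have "\<forall>\<^sub>F n in sequentially. T n < \<kappa> * sqrt (f 0 * exp (-1))"
    using \<kappa>(1) f0 by (intro order_tendstoD) auto
  then obtain n where n: "T n < \<kappa> * sqrt (f 0 * exp (-1))"
    by (auto simp: eventually_sequentially)
  \<comment> \<open>If \<open>norm x\<close> is at least \<open>R\<close>, the midpoint of
    \<open>x0\<close> and \<open>x\<close> has norm at least \<open>n + r\<close>, so the ball of
    radius \<open>r\<close> around it stays outside the ball of radius \<open>n\<close>.\<close>
  define R where "R = 2 * real n + norm x0 + 2 * r"
  have R: "0 < R"
    using \<kappa>(2) by (simp add: R_def add_nonneg_pos)
  have far: "f x \<le> f 0 * exp (-1)" if x: "R \<le> norm x" for x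
  proof -
    have sub: "ball ((1/2) *\<^sub>R (x0 + x)) r \<subseteq> {y. real n \<le> norm y}"
    proof
      fix y assume "y \<in> ball ((1/2) *\<^sub>R (x0 + x)) r"
      then have 1: "norm ((1/2) *\<^sub>R (x0 + x) - y) < r"
        by (simp add: dist_norm)
      have "norm x - norm x0 \<le> norm (x0 + x)"
        using norm_triangle_ineq4[of "x0 + x" x0] by simp
      moreover have "norm ((1/2) *\<^sub>R (x0 + x)) \<le> norm ((1/2) *\<^sub>R (x0 + x) - y) + norm y"
        using norm_triangle_ineq[of "(1/2) *\<^sub>R (x0 + x) - y" y] by simp
      moreover have "norm ((1/2) *\<^sub>R (x0 + x)) = norm (x0 + x) / 2"
        by simp
      ultimately show "y \<in> {y. real n \<le> norm y}"
        using x 1 unfolding R_def mem_Collect_eq by linarith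
    qed
    have "\<kappa> * sqrt (f x) \<le> (LINT y|lebesgue. indicator (ball ((1/2) *\<^sub>R (x0 + x)) r) y * f y)"
      by (rule \<kappa>(3))
    also have "\<dots> \<le> T n"
      unfolding T_def
    proof (rule integral_mono)
      show "integrable lebesgue (\<lambda>y. indicator (ball ((1/2) *\<^sub>R (x0 + x)) r) y * f y)"
        using integrable_mult_indicator[OF _ int, of "ball ((1/2) *\<^sub>R (x0 + x)) r"] by simp
    qed (use intT sub nonneg in \<open>auto split: split_indicator\<close>)
    also note n
    finally have "sqrt (f x) < sqrt (f 0 * exp (-1))"
      using \<kappa>(1) by simp
    then show ?thesis
      by simp
  qed
  show thesis
  proof (rule that)
    show "0 < 1 / R"
      using R by simp
    \<comment> \<open>The factor \<open>exp 1\<close> makes the bound follow from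
      \<open>f x \<le> f 0\<close> wherever \<open>norm x \<le> R\<close>.\<close>
    show "f x \<le> f 0 * exp 1 * exp (- (1 / R * norm x))" for x
    proof (cases "norm x \<le> R \<or> f x = 0")
      case True
      then have "f x \<le> f 0 \<and> norm x / R \<le> 1 \<or> f x = 0"
        using R max by auto
      moreover have "f 0 * 1 \<le> f 0 * exp (1 - 1 / R * norm x)" if "norm x / R \<le> 1"
        using f0 that by (intro mult_left_mono) auto
      moreover have "exp 1 * exp (- (1 / R * norm x)) = exp (1 - 1 / R * norm x)"
        by (simp add: exp_add[symmetric])
      ultimately show ?thesis
        using f0 by (auto simp: mult.assoc intro: order_trans)
    next
      case False
      \<comment> \<open>\<open>t *\<^sub>R x\<close> is the point of norm \<open>R\<close> on the
        segment from 0 to \<open>x\<close>.\<close>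
      define t where "t = R / norm x"
      have "R < norm x" "0 < norm x"
        using False R by auto
      then have t: "0 < t" "t < 1"
        using R by (auto simp: t_def)
      have fx: "0 < f x"
        using False nonneg[of x] by auto
      have "f 0 powr (1 - t) * f x powr t \<le> f (t *\<^sub>R x)"
        using geom_concaveD[OF f t, of 0 x] by simp
      also have "\<dots> \<le> f 0 * exp (-1)"
        using False R by (intro far) (auto simp: t_def)
      finally have "ln (f 0 powr (1 - t) * f x powr t) \<le> ln (f 0 * exp (-1))"
        using f0 fx by (intro ln_mono) auto
      then have "(1 - t) * ln (f 0) + t * ln (f x) \<le> ln (f 0) - 1"
        using f0 fx by (simp add: ln_mult ln_powr)
      then have "t * ln (f x) \<le> t * (ln (f 0) - 1 / t)"
        using t by (simp add: algebra_simps)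
      then have "ln (f x) \<le> ln (f 0) - 1 / t"
        using t by simp
      then have "exp (ln (f x)) \<le> exp (ln (f 0) - 1 / t)"
        by simp
      then have "f x \<le> f 0 * exp (- (1 / R * norm x))"
        using f0 fx by (simp add: exp_diff exp_minus t_def field_simps)
      also have "\<dots> \<le> f 0 * exp 1 * exp (- (1 / R * norm x))"
        using f0 by simp
      finally show ?thesis .
    qed
  qed
qed

section \<open>Integrability from exponential decay\<close>

lemma integrable_of_exp_decay:
  fixes f :: "'a::euclidean_space \<Rightarrow> 'b::euclidean_space"
  assumes "f \<in> borel_measurable lborel" "0 < a" "\<And>x. norm (f x) \<le> C * exp (- (a * norm x))"
  shows "integrable lborel f"
proof (rule Bochner_Integration.integrable_bound)
  show "integrable lborel (\<lambda>x::'a. C * exp (- (a * norm x)))"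
    using assms(2) by (intro integrable_mult_right integrable_exp_minus_norm)
  show "AE x in lborel. norm (f x) \<le> norm (C * exp (- (a * norm x)))"
    using assms(3) by (auto intro: order_trans[OF _ abs_ge_self])
qed (use assms in auto)

text \<open>\<open>sqrt u\<close> controls small values and \<open>u\<^sup>2\<close> large ones, and
  both inherit exponential decay from \<open>u\<close>. The two halves are
  \<open>ln w \<le> w - 1\<close> at \<open>w = u\<close> and at
  \<open>w = 1 / sqrt u\<close>.\<close>

lemma abs_mult_ln_le:
  fixes u :: real
  assumes "0 \<le> u"
  shows "\<bar>u * ln u\<bar> \<le> 2 * sqrt u + u\<^sup>2"
proof (cases "u = 0")
  case False
  then have u: "0 < u"
    using assms by simp
  have 1: "u * ln u \<le> u * u"
    using u ln_le_minus_one[of u] by (intro mult_left_mono) auto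
  have "- ln u = 2 * ln (1 / sqrt u)"
    using u by (simp add: ln_div ln_sqrt)
  also have "\<dots> \<le> 2 * (1 / sqrt u)"
    using u ln_le_minus_one[of "1 / sqrt u"] by (intro mult_left_mono) auto
  finally have "u * (- ln u) \<le> u * (2 * (1 / sqrt u))"
    using u by (intro mult_left_mono) auto
  also have "\<dots> = 2 * sqrt u"
    using u by (simp add: field_simps)
  finally have 2: "- (u * ln u) \<le> 2 * sqrt u"
    by simp
  have "0 \<le> sqrt u" "0 \<le> u\<^sup>2"
    using u by auto
  then show ?thesis
    using 1 2 unfolding power2_eq_square abs_le_iff by linarith
qed simp

lemma
  fixes F :: "'a::euclidean_space \<Rightarrow> real"
  assumes F [measurable]: "F \<in> borel_measurable borel" and nonneg: "\<And>x. 0 \<le> F x"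
    and a: "0 < a" and decay: "\<And>x. F x \<le> C * exp (- (a * norm x))"
  shows integrable_mult_ln_of_exp_decay: "integrable lborel (\<lambda>x. F x * ln (F x))"
    and integrable_scaleR_of_exp_decay: "integrable lborel (\<lambda>x. F x *\<^sub>R x)"
proof -
  have C: "0 \<le> C"
    using nonneg[of 0] decay[of 0] by simp
  show "integrable lborel (\<lambda>x. F x * ln (F x))"
  proof (rule integrable_of_exp_decay)
    fix x :: 'a
    let ?E = "\<lambda>b. exp (- (b * norm x))"
    have "norm (F x * ln (F x)) \<le> 2 * sqrt (F x) + (F x)\<^sup>2"
      using abs_mult_ln_le[OF nonneg[of x]] by simp
    also have "\<dots> \<le> 2 * sqrt (C * ?E a) + (C * ?E a)\<^sup>2"
      using decay[of x] nonneg[of x] by (intro add_mono mult_left_mono real_sqrt_le_mono power_mono) auto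
    also have "sqrt (C * ?E a) = sqrt C * ?E (a/2)"
    proof -
      have "?E a = (?E (a/2))\<^sup>2"
        by (simp add: power2_eq_square exp_add[symmetric])
      then show ?thesis
        by (simp add: real_sqrt_mult)
    qed
    also have "(C * ?E a)\<^sup>2 \<le> C\<^sup>2 * ?E (a/2)"
    proof -
      have "(?E a)\<^sup>2 = ?E (2 * a)"
        by (simp add: power2_eq_square exp_add[symmetric])
      also have "\<dots> \<le> ?E (a/2)"
        using a by (auto intro!: mult_right_mono)
      finally show ?thesis
        by (simp add: power_mult_distrib mult_left_mono)
    qed
    finally show "norm (F x * ln (F x)) \<le> (2 * sqrt C + C\<^sup>2) * exp (- (a / 2 * norm x))"
      by (simp add: algebra_simps)
  qed (use a in auto)
  show "integrable lborel (\<lambda>x. F x *\<^sub>R x)"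
  proof (rule integrable_of_exp_decay)
    fix x :: 'a
    \<comment> \<open>The linear factor \<open>norm x\<close> is paid for with half of the rate
      \<open>a\<close>.\<close>
    have "a / 2 * norm x \<le> exp (a / 2 * norm x)"
      using exp_ge_add_one_self[of "a / 2 * norm x"] by linarith
    then have n: "norm x \<le> 2 / a * exp (a / 2 * norm x)"
      using a by (simp add: field_simps)
    have "norm (F x *\<^sub>R x) = F x * norm x"
      using nonneg[of x] by simp
    also have "\<dots> \<le> (C * exp (- (a * norm x))) * (2 / a * exp (a / 2 * norm x))"
      using decay[of x] nonneg[of x] n C by (intro mult_mono) auto
    also have "\<dots> = C * 2 / a * (exp (- (a * norm x)) * exp (a / 2 * norm x))"
      by simp
    also have "exp (- (a * norm x)) * exp (a / 2 * norm x) = exp (- (a / 2 * norm x))"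
      by (simp add: exp_add[symmetric] field_simps)
    finally show "norm (F x *\<^sub>R x) \<le> C * 2 / a * exp (- (a / 2 * norm x))" .
  qed (use a in auto)
qed

text \<open>Lets the two suprema in the log-concavity of \<open>asplund\<close> be taken one at a
  time. Solving for \<open>p u\<close> gives a bound free of \<open>u\<close>, to which the supremum
  can be applied.\<close>

lemma powr_cSUP_mult_le:
  fixes p :: "'i \<Rightarrow> real"
  assumes le: "\<And>u. p u powr s * c \<le> K" and s: "0 < s" and c: "0 \<le> c"
    and p: "\<And>u. 0 \<le> p u" "bdd_above (range p)"
  shows "(SUP u. p u) powr s * c \<le> K"
proof (cases "c = 0")
  case True
  then show ?thesis
    using le by simp
next
  case False
  then have c: "0 < c"
    using c by simp
  have K: "0 \<le> K"
    using le[of undefined] c by (meson less_imp_le mult_nonneg_nonneg order_trans powr_ge_zero)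
  have "p u \<le> (K / c) powr (1 / s)" for u
  proof -
    have "p u powr s \<le> K / c"
      using le[of u] c by (simp add: field_simps)
    then have "(p u powr s) powr (1 / s) \<le> (K / c) powr (1 / s)"
      using s by (intro powr_mono2) auto
    then show ?thesis
      using s p(1)[of u] by (simp add: powr_powr)
  qed
  then have "(SUP u. p u) \<le> (K / c) powr (1 / s)"
    by (intro cSUP_least) auto
  moreover have "0 \<le> (SUP u. p u)"
    using p(1)[of undefined] cSUP_upper[OF UNIV_I p(2)] by (meson order_trans)
  ultimately have "(SUP u. p u) powr s \<le> ((K / c) powr (1 / s)) powr s"
    using s by (intro powr_mono2) auto
  also have "\<dots> = K / c"
    using s K c by (simp add: powr_powr)
  finally show ?thesis
    using c by (simp add: field_simps)
qed

section \<open>The Asplund product of decaying log-concave functions\<close>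

context
  fixes f g :: "'a::euclidean_space \<Rightarrow> real" and a b C D :: real
  assumes f: "geom_concave f" and g: "geom_concave g"
    and ab: "0 < a" "0 < b"
    and f_decay: "\<And>x. f x \<le> C * exp (- (a * norm x))"
    and g_decay: "\<And>x. g x \<le> D * exp (- (b * norm x))"
begin

lemma asplund_term_decay: "f y * g (z - y) \<le> C * D * exp (- (min a b * norm z))"
proof -
  have CD: "0 \<le> C" "0 \<le> D"
    using f_decay[of 0] g_decay[of 0] geom_concave_nonneg[OF f, of 0] geom_concave_nonneg[OF g, of 0] by auto
  have "f y * g (z - y) \<le> (C * exp (- (a * norm y))) * (D * exp (- (b * norm (z - y))))"
    using f_decay g_decay geom_concave_nonneg[OF g] CD by (intro mult_mono) auto
  also have "\<dots> = C * D * exp (- (a * norm y + b * norm (z - y)))"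
    by (simp add: exp_add[symmetric])
  also have "\<dots> \<le> C * D * exp (- (min a b * norm z))"
  proof -
    have "min a b * norm z \<le> min a b * (norm y + norm (z - y))"
      using ab norm_triangle_ineq[of y "z - y"] by (intro mult_left_mono) auto
    also have "\<dots> \<le> a * norm y + b * norm (z - y)"
      by (auto simp: distrib_left intro!: add_mono mult_right_mono)
    finally show ?thesis
      using CD by (intro mult_left_mono) auto
  qed
  finally show ?thesis .
qed

lemma asplund_upper: "f x * g y \<le> asplund f g (x + y)"
  unfolding asplund_def
proof (rule cSUP_upper2)
  show "bdd_above (range (\<lambda>u. f u * g (x + y - u)))"
    using asplund_term_decay by (intro bdd_aboveI2)
  show "f x * g y \<le> f x * g (x + y - x)"
    by simp
qed simp

lemma asplund_decay: "asplund f g z \<le> C * D * exp (- (min a b * norm z))"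
  unfolding asplund_def by (intro cSUP_least asplund_term_decay) simp

lemma asplund_nonneg: "0 \<le> asplund f g z"
  using asplund_upper[of z 0] geom_concave_nonneg[OF f, of z] geom_concave_nonneg[OF g, of 0]
  by (metis add.right_neutral mult_nonneg_nonneg order_trans)

text \<open>Convex combinations of a splitting \<open>u + (x - u)\<close> of \<open>x\<close> and a
  splitting \<open>v + (y - v)\<close> of \<open>y\<close> are splittings of the combined point; the
  suprema over \<open>u\<close> and \<open>v\<close> follow.\<close>

lemma geom_concave_asplund: "geom_concave (asplund f g)"
  unfolding geom_concave_def
proof (intro conjI allI impI asplund_nonneg)
  fix x y :: 'a and t :: real assume t: "0 < t" "t < 1"
  let ?P = "asplund f g" and ?z = "(1 - t) *\<^sub>R x + t *\<^sub>R y"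
  have pt: "(f u * g (x - u)) powr (1 - t) * (f v * g (y - v)) powr t \<le> ?P ?z" for u v
  proof -
    have "(f u * g (x - u)) powr (1 - t) * (f v * g (y - v)) powr t
        = (f u powr (1 - t) * f v powr t) * (g (x - u) powr (1 - t) * g (y - v) powr t)"
      using geom_concave_nonneg[OF f] geom_concave_nonneg[OF g] by (simp add: powr_mult)
    also have "\<dots> \<le> f ((1 - t) *\<^sub>R u + t *\<^sub>R v) * g ((1 - t) *\<^sub>R (x - u) + t *\<^sub>R (y - v))"
      using geom_concave_nonneg[OF f] by (intro mult_mono geom_concaveD f g t) auto
    also have "\<dots> \<le> ?P (((1 - t) *\<^sub>R u + t *\<^sub>R v) + ((1 - t) *\<^sub>R (x - u) + t *\<^sub>R (y - v)))"
      by (rule asplund_upper)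
    also have "((1 - t) *\<^sub>R u + t *\<^sub>R v) + ((1 - t) *\<^sub>R (x - u) + t *\<^sub>R (y - v)) = ?z"
      by (simp add: algebra_simps)
    finally show ?thesis .
  qed
  have bdd: "bdd_above (range (\<lambda>u. f u * g (w - u)))" for w
    using asplund_term_decay by (intro bdd_aboveI2)
  have nn: "0 \<le> f u * g w" for u w
    using geom_concave_nonneg[OF f] geom_concave_nonneg[OF g] by simp
  have "?P x powr (1 - t) * (f v * g (y - v)) powr t \<le> ?P ?z" for v
    by (rule powr_cSUP_mult_le[of "\<lambda>u. f u * g (x - u)", folded asplund_def, OF pt])
       (use t bdd nn in auto)
  then have "(f v * g (y - v)) powr t * ?P x powr (1 - t) \<le> ?P ?z" for v
    by (simp add: mult.commute)
  then have "?P y powr t * ?P x powr (1 - t) \<le> ?P ?z"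
    by (rule powr_cSUP_mult_le[of "\<lambda>u. f u * g (y - u)", folded asplund_def])
       (use t bdd nn in auto)
  then show "?P x powr (1 - t) * ?P y powr t \<le> ?P ?z"
    by (simp add: mult.commute)
qed

lemma integrable_open_part_asplund: "integrable lborel (open_part (asplund f g))"
proof (rule integrable_of_exp_decay)
  show "open_part (asplund f g) \<in> borel_measurable lborel"
    using geom_concave_asplund by simp
  show "0 < min a b"
    using ab by simp
  show "norm (open_part (asplund f g) z) \<le> C * D * exp (- (min a b * norm z))" for z
    using open_part_le[OF geom_concave_asplund, of z] asplund_decay[of z]
      geom_concave_nonneg[OF geom_concave_open_part[OF geom_concave_asplund], of z] by simp
qed

end

subsection \<open>The lower bound for the convolution at the origin\<close>

lemma nn_integral_lborel_translate:
  fixes u :: "'a::euclidean_space \<Rightarrow> ennreal"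
  assumes [measurable]: "u \<in> borel_measurable borel"
  shows "(\<integral>\<^sup>+x. u (c + x) \<partial>lborel) = (\<integral>\<^sup>+x. u x \<partial>lborel)"
  by (subst (2) lborel_distr_plus[of c, symmetric]) (simp add: nn_integral_distr)

text \<open>Compares a signed integrand with an upper bound that need not be integrable;
  \<open>ennreal\<close> cuts off the negative part.\<close>

lemma ennreal_integral_le_nn_integral:
  assumes u: "integrable M u" and le: "\<And>x. ennreal (u x) \<le> v x"
  shows "ennreal (LINT x|M. u x) \<le> (\<integral>\<^sup>+x. v x \<partial>M)"
proof -
  have "ennreal (LINT x|M. u x) \<le> ennreal (LINT x|M. max 0 (u x))"
    using u by (intro ennreal_leI integral_mono) auto
  also have "\<dots> = (\<integral>\<^sup>+x. ennreal (max 0 (u x)) \<partial>M)"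
    using u by (intro nn_integral_eq_integral[symmetric]) auto
  also have "\<dots> \<le> (\<integral>\<^sup>+x. v x \<partial>M)"
    using le by (intro nn_integral_mono) (auto simp: max_def ennreal_neg)
  finally show ?thesis .
qed

lemma not_AE_lborel_open:
  fixes S :: "'a::euclidean_space set"
  assumes "open S" "S \<noteq> {}"
  shows "\<not> (AE x in lborel. x \<notin> S)"
proof
  assume "AE x in lborel. x \<notin> S"
  then have "S \<in> null_sets lborel"
    using assms(1) by (subst (asm) AE_iff_null_sets[symmetric]) auto
  then have "S \<in> null_sets lebesgue"
    by (rule null_sets_completionI)
  then show False
    using open_not_negligible[OF assms] by (simp add: negligible_iff_null_sets)
qed

text \<open>This set is the strict hypograph of \<open>ln H\<close>; written with \<open>exp\<close>
  it needs no logarithm where \<open>H\<close> is 0 or infinite.\<close>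

lemma convex_exp_hypograph:
  fixes H :: "'a::real_vector \<Rightarrow> ennreal"
  assumes "\<And>x y t. 0 < t \<Longrightarrow> t < 1 \<Longrightarrow> geom_less t (H x) (H y) (H ((1 - t) *\<^sub>R x + t *\<^sub>R y))"
  shows "convex {(z, s). ennreal (exp s) < H z}"
  unfolding convex_alt
proof (intro ballI allI impI)
  fix v w and t :: real assume vw: "v \<in> {(z, s). ennreal (exp s) < H z}" "w \<in> {(z, s). ennreal (exp s) < H z}"
    and "0 \<le> t \<and> t \<le> 1"
  then consider "t = 0" | "t = 1" | "0 < t" "t < 1"
    by linarith
  then show "(1 - t) *\<^sub>R v + t *\<^sub>R w \<in> {(z, s). ennreal (exp s) < H z}"
  proof cases
    case 3
    obtain x r y s where v: "v = (x, r)" and w: "w = (y, s)"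
      by (cases v, cases w)
    have "ennreal (exp r powr (1 - t) * exp s powr t) < H ((1 - t) *\<^sub>R x + t *\<^sub>R y)"
      using assms[OF 3, of x y] vw by (simp add: geom_less_def v w)
    moreover have "exp r powr (1 - t) * exp s powr t = exp ((1 - t) * r + t * s)"
      by (simp add: powr_def exp_add)
    ultimately show ?thesis
      by (simp add: v w)
  qed (use vw in auto)
qed

text \<open>\<open>F\<close> and \<open>G\<close> stand for the two given functions, \<open>Q\<close> for their Asplund product.\<close>

locale opposite_barycenters =
  fixes F G Q :: "'a::euclidean_space \<Rightarrow> real" and K :: real
  assumes F: "geom_concave F" and G: "geom_concave G"
    and F_meas [measurable]: "F \<in> borel_measurable borel" and G_meas [measurable]: "G \<in> borel_measurable borel"
    and openF: "open {x. 0 < F x}" and openG: "open {x. 0 < G x}"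
    and intF: "integrable lborel F" and intG: "integrable lborel G"
    and posF: "0 < (LINT x|lborel. F x)" and posG: "0 < (LINT x|lborel. G x)"
    and G_le: "\<And>x. G x \<le> K"
    and lnF: "integrable lborel (\<lambda>x. F x * ln (F x))" and lnG: "integrable lborel (\<lambda>x. G x * ln (G x))"
    and momF: "integrable lborel (\<lambda>x. F x *\<^sub>R x)" and momG: "integrable lborel (\<lambda>x. G x *\<^sub>R x)"
    and bary: "(LINT x|lborel. F x *\<^sub>R x) /\<^sub>R (LINT x|lborel. F x)
      = - ((LINT x|lborel. G x *\<^sub>R x) /\<^sub>R (LINT x|lborel. G x))"
    and Q_meas [measurable]: "Q \<in> borel_measurable borel" and intQ: "integrable lborel Q"
    and Q_nonneg: "\<And>x. 0 \<le> Q x" and Q_upper: "\<And>x y. F x * G y \<le> Q (x + y)"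
begin

abbreviation (input) "mF \<equiv> LINT x|lborel. F x"
abbreviation (input) "mG \<equiv> LINT x|lborel. G x"
abbreviation (input) "mQ \<equiv> LINT x|lborel. Q x"
abbreviation (input) "bG \<equiv> (LINT x|lborel. G x *\<^sub>R x) /\<^sub>R mG"
text \<open>\<open>sF\<close> and \<open>sG\<close> are minus the entropies of \<open>F\<close> and
  \<open>G\<close>. \<open>H\<close> is their convolution as a nonnegative integral, defined at
  every point before any integrability is known.\<close>

abbreviation (input) "sF \<equiv> (LINT x|lborel. F x * ln (F x)) / mF"
abbreviation (input) "sG \<equiv> (LINT x|lborel. G x * ln (G x)) / mG"
abbreviation (input) "H \<equiv> \<lambda>z. \<integral>\<^sup>+y. ennreal (F y * G (z - y)) \<partial>lborel"

lemma F_nonneg: "0 \<le> F x" and G_nonneg: "0 \<le> G x"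
  using F G by (auto simp: geom_concave_def)

lemma nonempty_support: "\<exists>x. 0 < F x" "\<exists>x. 0 < G x"
proof -
  have *: "\<exists>x. 0 < u x" if "0 < (LINT x|lborel. u x)" "\<And>x. 0 \<le> u x" for u :: "'a \<Rightarrow> real"
  proof (rule ccontr)
    assume "\<nexists>x. 0 < u x"
    then have "u x = 0" for x
      using that(2)[of x] \<open>\<nexists>x. 0 < u x\<close> by (simp add: order_antisym not_less)
    then show False
      using that(1) by simp
  qed
  show "\<exists>x. 0 < F x" "\<exists>x. 0 < G x"
    by (rule *[OF posF F_nonneg], rule *[OF posG G_nonneg])
qed

lemma mQ_pos: "0 < mQ"
proof -
  obtain y where y: "0 < G y"
    using nonempty_support by blast
  have "(\<integral>\<^sup>+x. ennreal (G y * F x) \<partial>lborel) \<le> (\<integral>\<^sup>+x. ennreal (Q (y + x)) \<partial>lborel)"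
    using Q_upper by (intro nn_integral_mono ennreal_leI) (simp add: ac_simps)
  also have "\<dots> = (\<integral>\<^sup>+x. ennreal (Q x) \<partial>lborel)"
    by (intro nn_integral_lborel_translate) simp
  also have "\<dots> = ennreal mQ"
    using intQ Q_nonneg by (intro nn_integral_eq_integral) auto
  also have "(\<integral>\<^sup>+x. ennreal (G y * F x) \<partial>lborel) = ennreal (LINT x|lborel. G y * F x)"
    using intF F_nonneg y by (intro nn_integral_eq_integral) auto
  finally have "G y * mF \<le> mQ"
    using Bochner_Integration.integral_nonneg[of lborel Q] Q_nonneg by (simp add: ennreal_le_iff)
  then show ?thesis
    using y posF by (smt (verit) mult_pos_pos)
qed

lemma H_finite: "H z < top"
proof -
  have "F y * G (z - y) \<le> K * F y" for y
    using mult_left_mono[OF G_le[of "z - y"] F_nonneg[of y]] by (simp add: mult.commute)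
  then have "H z \<le> (\<integral>\<^sup>+y. ennreal (K * F y) \<partial>lborel)"
    by (intro nn_integral_mono ennreal_leI)
  also have "\<dots> = ennreal (LINT y|lborel. K * F y)"
  proof (intro nn_integral_eq_integral AE_I2 mult_nonneg_nonneg F_nonneg)
    show "0 \<le> K"
      using G_nonneg[of 0] G_le[of 0] by simp
  qed (use intF in auto)
  also have "\<dots> < top"
    by simp
  finally show ?thesis .
qed

text \<open>\<open>F u * G (z - u)\<close> is log-concave jointly in \<open>u\<close> and
  \<open>z\<close>, and Prekopa-Leindler in \<open>u\<close> passes this on to the integral.\<close>

lemma H_geom_less:
  assumes t: "0 < t" "t < 1"
  shows "geom_less t (H x) (H y) (H ((1 - t) *\<^sub>R x + t *\<^sub>R y))"
proof (rule prekopa_leindler[OF t])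
  fix u v :: 'a
  let ?z = "(1 - t) *\<^sub>R x + t *\<^sub>R y" and ?w = "(1 - t) *\<^sub>R u + t *\<^sub>R v"
  have z: "?z - ?w = (1 - t) *\<^sub>R (x - u) + t *\<^sub>R (y - v)"
    by (simp add: algebra_simps)
  have "(F u * G (x - u)) powr (1 - t) * (F v * G (y - v)) powr t
      = (F u powr (1 - t) * F v powr t) * (G (x - u) powr (1 - t) * G (y - v) powr t)"
    using F_nonneg G_nonneg by (simp add: powr_mult)
  also have "\<dots> \<le> F ?w * G (?z - ?w)"
    unfolding z using F_nonneg by (intro mult_mono geom_concaveD F G t) auto
  finally have le: "(F u * G (x - u)) powr (1 - t) * (F v * G (y - v)) powr t \<le> F ?w * G (?z - ?w)" .
  show "geom_less t (ennreal (F u * G (x - u))) (ennreal (F v * G (y - v))) (ennreal (F ?w * G (?z - ?w)))"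
    unfolding geom_less_def
  proof (intro allI impI)
    fix p q :: real assume "0 < p" "0 < q" "ennreal p < ennreal (F u * G (x - u))" "ennreal q < ennreal (F v * G (y - v))"
    then have pq: "0 < p" "0 < q" "p < F u * G (x - u)" "q < F v * G (y - v)"
      by (auto simp: ennreal_less_iff)
    then have "p powr (1 - t) * q powr t < (F u * G (x - u)) powr (1 - t) * (F v * G (y - v)) powr t"
      using t by (intro mult_strict_mono powr_less_mono2) auto
    also note le
    finally have "p powr (1 - t) * q powr t < F ?w * G (?z - ?w)" .
    moreover have "0 < p powr (1 - t) * q powr t"
      using pq by simp
    ultimately show "ennreal (p powr (1 - t) * q powr t) < ennreal (F ?w * G (?z - ?w))"
      by (intro ennreal_lessI) linarith+
  qed
qed measurable

text \<open>The open supports pay off here: the integrand is positive on an open set that contains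
  \<open>x\<close>, not merely at \<open>x\<close>.\<close>

lemma H_pos:
  assumes "0 < F x" "0 < G y"
  shows "0 < H (x + y)"
proof (rule ccontr)
  assume "\<not> 0 < H (x + y)"
  then have "AE w in lborel. ennreal (F w * G (x + y - w)) = 0"
    by (subst nn_integral_0_iff_AE[symmetric]) auto
  moreover have "\<not> (AE w in lborel. w \<notin> {w. 0 < F w} \<inter> (\<lambda>w. x + y - w) -` {w. 0 < G w})"
  proof (rule not_AE_lborel_open)
    show "open ({w. 0 < F w} \<inter> (\<lambda>w. x + y - w) -` {w. 0 < G w})"
      by (intro open_Int openF open_vimage openG continuous_intros)
    show "{w. 0 < F w} \<inter> (\<lambda>w. x + y - w) -` {w. 0 < G w} \<noteq> {}"
      using assms by auto
  qed
  ultimately show False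
    using F_nonneg G_nonneg by (elim notE, elim eventually_mono) (auto simp: ennreal_eq_0_iff mult_le_0_iff not_less)
qed

lemma integral_inner_F: "(LINT x|lborel. F x * (a \<bullet> x)) = - (mF * (a \<bullet> bG))"
  and integrable_inner_F: "integrable lborel (\<lambda>x. F x * (a \<bullet> x))"
  and integral_inner_G: "(LINT x|lborel. G x * (a \<bullet> x)) = mG * (a \<bullet> bG)"
  and integrable_inner_G: "integrable lborel (\<lambda>x. G x * (a \<bullet> x))"
proof -
  have eq: "(\<lambda>x. u x * (a \<bullet> x)) = (\<lambda>x. a \<bullet> (u x *\<^sub>R x))" for u :: "'a \<Rightarrow> real"
    by simp
  show "integrable lborel (\<lambda>x. F x * (a \<bullet> x))" "integrable lborel (\<lambda>x. G x * (a \<bullet> x))"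
    unfolding eq by (rule integrable_inner_right[OF momF], rule integrable_inner_right[OF momG])
  have "(LINT x|lborel. F x *\<^sub>R x) = mF *\<^sub>R (- bG)"
    unfolding bary[symmetric] using posF by simp
  moreover have "(LINT x|lborel. F x * (a \<bullet> x)) = a \<bullet> (LINT x|lborel. F x *\<^sub>R x)"
    unfolding eq by (rule integral_inner_right[OF momF])
  ultimately show "(LINT x|lborel. F x * (a \<bullet> x)) = - (mF * (a \<bullet> bG))"
    by simp
  have "(LINT x|lborel. G x * (a \<bullet> x)) = a \<bullet> (LINT x|lborel. G x *\<^sub>R x)"
    unfolding eq by (rule integral_inner_right[OF momG])
  then show "(LINT x|lborel. G x * (a \<bullet> x)) = mG * (a \<bullet> bG)"
    using posG by simp
qed

text \<open>The barycenter of \<open>H\<close> is the origin, so no closed half-space bounded by a hyperplane through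
  the origin contains the (open) support of \<open>H\<close>.\<close>

lemma support_not_in_halfspace:
  assumes "\<And>x y. 0 < F x \<Longrightarrow> 0 < G y \<Longrightarrow> a \<bullet> (x + y) \<le> 0"
  shows "a = 0"
proof (rule ccontr)
  assume a: "a \<noteq> 0"
  \<comment> \<open>Averaging over \<open>y\<close> with weight \<open>G\<close> replaces
    \<open>y\<close> by the barycenter \<open>bG\<close>.\<close>
  have le: "a \<bullet> (x + bG) \<le> 0" if "0 < F x" for x
  proof -
    have "(LINT y|lborel. G y * (a \<bullet> x) + G y * (a \<bullet> y)) \<le> (LINT y|lborel. (\<lambda>_::'a. 0) y)"
    proof (rule integral_mono)
      show "G y * (a \<bullet> x) + G y * (a \<bullet> y) \<le> 0" for y
        using assms[OF that, of y] G_nonneg[of y]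
        by (cases "G y = 0") (auto simp: inner_add_right distrib_left[symmetric] mult_le_0_iff)
    qed (auto intro!: integrable_inner_G intG)
    also have "(LINT y|lborel. G y * (a \<bullet> x) + G y * (a \<bullet> y)) = mG * (a \<bullet> (x + bG))"
      using intG integrable_inner_G[of a]
      by (subst Bochner_Integration.integral_add) (auto simp: integral_inner_G inner_add_right distrib_left)
    finally show ?thesis
      using posG by (simp add: mult_le_0_iff)
  qed
  \<comment> \<open>The support of \<open>F\<close> is open, so \<open>x\<close> can be moved a
    little in direction \<open>a\<close>; this makes the inequality strict.\<close>
  have less: "a \<bullet> (x + bG) < 0" if x: "0 < F x" for x
  proof -
    obtain e where e: "0 < e" "ball x e \<subseteq> {x. 0 < F x}"
      using openF x open_contains_ball by blast
    define d where "d = e / (2 * norm a)"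
    have d: "0 < d"
      using e a by (simp add: d_def)
    have "x + d *\<^sub>R a \<in> ball x e"
      using e a by (simp add: dist_norm d_def)
    then have "a \<bullet> (x + d *\<^sub>R a + bG) \<le> 0"
      using e by (intro le) auto
    then have "a \<bullet> (x + bG) + d * (a \<bullet> a) \<le> 0"
      by (simp add: inner_add_right)
    moreover have "0 < d * (a \<bullet> a)"
      using d a by simp
    ultimately show ?thesis
      by linarith
  qed
  \<comment> \<open>Nonnegative, and of integral 0 because the barycenter of \<open>F\<close> is
    \<open>- bG\<close>; hence it vanishes almost everywhere, against strict positivity on the
    support of \<open>F\<close>.\<close>
  let ?u = "\<lambda>x. - (F x * (a \<bullet> x)) - F x * (a \<bullet> bG)"
  have u: "?u x = F x * - (a \<bullet> (x + bG))" for x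
    by (simp add: inner_add_right algebra_simps)
  have "(LINT x|lborel. ?u x) = 0"
    using integral_inner_F[of a] integrable_inner_F[of a] intF by simp
  then have "AE x in lborel. ?u x = 0"
  proof (subst (asm) integral_nonneg_eq_0_iff_AE)
    show "AE x in lborel. 0 \<le> ?u x"
    proof (rule AE_I2)
      fix x
      have "F x = 0 \<or> a \<bullet> (x + bG) \<le> 0"
        using le[of x] F_nonneg[of x] by linarith
      then show "0 \<le> ?u x"
        unfolding u using F_nonneg[of x] by (elim disjE) (auto intro: mult_nonneg_nonpos)
    qed
  qed (use integrable_inner_F[of a] intF in auto)
  then have "AE x in lborel. x \<notin> {x. 0 < F x}"
    unfolding u by eventually_elim (use less in fastforce)
  then show False
    using not_AE_lborel_open[OF openF] nonempty_support by blast
qed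

text \<open>Integrating the tangent bound of \<open>H\<close> against \<open>F x * G y\<close>, together with \<open>ln u \<le> u - 1\<close>
  for \<open>u\<close> the ratio of the normalized \<open>Q\<close> and \<open>H\<close>.\<close>

lemma tangent_bound_impossible:
  assumes tangent: "\<And>z. 0 < H z \<Longrightarrow> ln (enn2real (H z)) \<le> ln (mF * mG / mQ) + sF + sG - 1 + b \<bullet> z"
  shows False
proof -
  note pos = posF posG mQ_pos
  define h where "h z = enn2real (H z)" for z
  have Hh: "H z = ennreal (h z)" for z
    using H_finite[of z] by (simp add: h_def)
  have h_nonneg: "0 \<le> h z" for z
    by (simp add: h_def)
  have h_meas [measurable]: "h \<in> borel_measurable borel"
    unfolding h_def[abs_def] by measurable
  \<comment> \<open>The ratio of the densities \<open>Q / mQ\<close> and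
    \<open>h / (mF * mG)\<close>. Division by zero makes it 0 where \<open>h\<close> vanishes, which
    is harmless in the bound for \<open>h z * W z\<close>.\<close>
  define W where "W z = Q z * (mF * mG) / (mQ * h z)" for z
  have W_meas [measurable]: "W \<in> borel_measurable borel"
    unfolding W_def[abs_def] by measurable
  have W_nonneg: "0 \<le> W z" for z
    using Q_nonneg h_nonneg pos by (simp add: W_def)
  \<comment> \<open>\<open>mG * J x\<close> is the integral over \<open>y\<close> of
    \<open>F x * G y\<close> times the left-hand side of \<open>point\<close>.\<close>
  define J where "J x = F x * ln (F x) + F x * (2 - sF - b \<bullet> bG) - F x * (b \<bullet> x)" for x
  have intJ: "integrable lborel J"
    unfolding J_def[abs_def]
    using lnF intF integrable_inner_F[of b] by (intro Bochner_Integration.integrable_add Bochner_Integration.integrable_diff) auto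
  \<comment> \<open>The entropy terms cancel, and so do the terms in \<open>b\<close>, by opposite
    barycenters; only the constant 2 is left.\<close>
  have J: "(LINT x|lborel. mG * J x) = 2 * (mF * mG)"
  proof -
    have "(LINT x|lborel. J x) = mF * sF + mF * (2 - sF - b \<bullet> bG) + mF * (b \<bullet> bG)"
      unfolding J_def using lnF intF integrable_inner_F[of b] posF
      by (simp add: integral_inner_F Bochner_Integration.integral_add Bochner_Integration.integral_diff)
    then show ?thesis
      by (simp add: algebra_simps)
  qed
  \<comment> \<open>One unit of the constant 2 comes from \<open>ln u \<le> u - 1\<close>, the other
    is the \<open>- 1\<close> in \<open>tangent\<close>, that is, the factor
    \<open>e\<close>.\<close>
  have point: "ln (F x) + ln (G y) - sF - sG + 2 - b \<bullet> x - b \<bullet> y \<le> W (x + y)"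
    if "0 < F x" "0 < G y" for x y
  proof -
    let ?z = "x + y"
    have h: "0 < h ?z"
      using H_pos[OF that] by (simp add: Hh)
    have FQ: "0 < F x * G y" "F x * G y \<le> Q ?z"
      using that Q_upper by auto
    then have Q: "0 < Q ?z"
      by linarith
    have "ln (F x) + ln (G y) = ln (F x * G y)"
      using that by (simp add: ln_mult)
    also have "\<dots> \<le> ln (Q ?z)"
      using FQ Q by simp
    also have "\<dots> = ln (h ?z) - ln (mF * mG / mQ) + ln (W ?z)"
      using h Q pos by (simp add: W_def ln_mult ln_div)
    also have "\<dots> \<le> ln (h ?z) - ln (mF * mG / mQ) + (W ?z - 1)"
      using h Q pos by (intro add_left_mono ln_le_minus_one) (simp add: W_def)
    finally show ?thesis
      using tangent[OF H_pos[OF that]] by (simp add: h_def inner_add_right)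
  qed
  have "ennreal (2 * (mF * mG)) = ennreal (LINT x|lborel. mG * J x)"
    by (simp only: J)
  also have "\<dots> \<le> (\<integral>\<^sup>+x. (\<integral>\<^sup>+z. ennreal (F x * G (z - x)) * ennreal (W z) \<partial>lborel) \<partial>lborel)"
  proof (rule ennreal_integral_le_nn_integral)
    show "integrable lborel (\<lambda>x. mG * J x)"
      using intJ by simp
    fix x
    let ?c = "ln (F x) - sF - sG + 2 - b \<bullet> x"
    let ?u = "\<lambda>y. F x * (G y * ln (G y)) + F x * ?c * G y - F x * (G y * (b \<bullet> y))"
    have intu: "integrable lborel ?u"
      using lnG intG integrable_inner_G[of b]
      by (intro Bochner_Integration.integrable_add Bochner_Integration.integrable_diff integrable_mult_right) auto
    have "(LINT y|lborel. ?u y) = F x * (mG * sG) + F x * ?c * mG - F x * (mG * (b \<bullet> bG))"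
      using lnG intG integrable_inner_G[of b] posG
      by (simp add: integral_inner_G Bochner_Integration.integral_add Bochner_Integration.integral_diff)
    also have "\<dots> = mG * J x"
      by (simp add: J_def algebra_simps)
    finally have "ennreal (mG * J x) = ennreal (LINT y|lborel. ?u y)"
      by simp
    also have "\<dots> \<le> (\<integral>\<^sup>+y. ennreal (F x * G (x + y - x)) * ennreal (W (x + y)) \<partial>lborel)"
    proof (rule ennreal_integral_le_nn_integral[OF intu])
      fix y
      have "?u y = F x * G y * (ln (F x) + ln (G y) - sF - sG + 2 - b \<bullet> x - b \<bullet> y)"
        by (simp add: algebra_simps)
      also have "\<dots> \<le> F x * G y * W (x + y)"
      proof (cases "F x = 0 \<or> G y = 0")
        case False
        then have "0 < F x" "0 < G y"
          using F_nonneg[of x] G_nonneg[of y] by auto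
        then show ?thesis
          by (intro mult_left_mono point) auto
      qed auto
      finally have "ennreal (?u y) \<le> ennreal (F x * G y * W (x + y))"
        by (rule ennreal_leI)
      also have "\<dots> = ennreal (F x * G (x + y - x)) * ennreal (W (x + y))"
        using F_nonneg G_nonneg W_nonneg by (simp add: ennreal_mult)
      finally show "ennreal (?u y) \<le> ennreal (F x * G (x + y - x)) * ennreal (W (x + y))" .
    qed
    \<comment> \<open>In the variable \<open>z = x + y\<close> the factor \<open>W z\<close> is free
      of \<open>x\<close>, so that after exchanging the integrals the inner one is
      \<open>H z\<close>.\<close>
    also have "\<dots> = (\<integral>\<^sup>+z. ennreal (F x * G (z - x)) * ennreal (W z) \<partial>lborel)"
      by (intro nn_integral_lborel_translate) measurable
    finally show "ennreal (mG * J x) \<le> (\<integral>\<^sup>+z. ennreal (F x * G (z - x)) * ennreal (W z) \<partial>lborel)" .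
  qed
  also have "\<dots> = (\<integral>\<^sup>+z. (\<integral>\<^sup>+x. ennreal (F x * G (z - x)) * ennreal (W z) \<partial>lborel) \<partial>lborel)"
    by (intro lborel_pair.Fubini') measurable
  also have "\<dots> = (\<integral>\<^sup>+z. H z * ennreal (W z) \<partial>lborel)"
    by (intro nn_integral_cong nn_integral_multc) measurable
  also have "\<dots> \<le> (\<integral>\<^sup>+z. ennreal (mF * mG / mQ * Q z) \<partial>lborel)"
  proof (intro nn_integral_mono)
    fix z
    have "h z * W z \<le> mF * mG / mQ * Q z"
      using pos Q_nonneg[of z] by (cases "h z = 0") (auto simp: W_def mult_ac)
    then show "H z * ennreal (W z) \<le> ennreal (mF * mG / mQ * Q z)"
      using h_nonneg[of z] W_nonneg[of z] by (auto simp: Hh ennreal_mult[symmetric] intro!: ennreal_leI)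
  qed
  also have "\<dots> = ennreal (LINT z|lborel. mF * mG / mQ * Q z)"
    using intQ Q_nonneg pos by (intro nn_integral_eq_integral) auto
  also have "(LINT z|lborel. mF * mG / mQ * Q z) = mF * mG"
    using pos by simp
  finally have "2 * (mF * mG) \<le> mF * mG"
    using pos by (simp add: ennreal_le_iff)
  then show False
    using pos by (simp add: mult_pos_pos not_le)
qed

text \<open>It suffices that \<open>(0, c)\<close> lies in the strict hypograph. Otherwise a
  hyperplane separates it; the sign of its last coefficient \<open>\<alpha>\<close> decides which
  contradiction arises.\<close>

lemma mass_product_le: "mF * mG \<le> exp (1 - sF - sG) * (LINT y|lborel. F y * G (- y)) * mQ"
proof -
  note pos = posF posG mQ_pos
  \<comment> \<open>The height for which
    \<open>exp c * exp (1 - sF - sG) * mQ = mF * mG\<close>.\<close>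
  define c where "c = ln (mF * mG / mQ) + sF + sG - 1"
  define S where "S = {(z, s). ennreal (exp s) < H z}"
  have "(0, c) \<in> S"
  proof (rule ccontr)
    assume notin: "(0, c) \<notin> S"
    obtain x0 y0 where xy0: "0 < F x0" "0 < G y0"
      using nonempty_support by blast
    \<comment> \<open>\<open>S\<close> reaches arbitrarily far down over each point where
      \<open>H\<close> is positive, which excludes \<open>\<alpha> < 0\<close>.\<close>
    have below: "\<exists>s. (z, s) \<in> S \<and> s \<le> r" if Hz: "0 < H z" for z r
    proof -
      obtain p where p: "0 < p" "ennreal p < H z"
      proof -
        obtain d where "0 < d" "d < H z"
          using dense[OF Hz] by blast
        then show thesis
          using that by (cases d) auto
      qed
      have "exp (min (ln p) r) \<le> p"
        using p(1) by (simp add: min_def ln_ge_iff[symmetric] not_le)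
      then have "(z, min (ln p) r) \<in> S"
        using p(2) by (auto simp: S_def intro: le_less_trans[OF ennreal_leI])
      then show ?thesis
        by (intro exI[of _ "min (ln p) r"]) auto
    qed
    have "convex S"
      unfolding S_def by (intro convex_exp_hypograph H_geom_less)
    moreover have "S \<noteq> {}"
      using below[OF H_pos[OF xy0]] by blast
    ultimately have "\<exists>n d. n \<noteq> 0 \<and> (\<forall>w\<in>S. n \<bullet> w \<le> d) \<and> (\<forall>w\<in>{(0, c)}. d \<le> n \<bullet> w)"
      using notin by (intro separating_hyperplane_sets) auto
    then obtain n d where n: "n \<noteq> 0" "\<forall>w\<in>S. n \<bullet> w \<le> d" "d \<le> n \<bullet> (0, c)"
      by blast
    obtain a \<alpha> where a: "n = (a, \<alpha>)"
      by (cases n)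
    have sep: "a \<bullet> z + \<alpha> * s \<le> \<alpha> * c" if "(z, s) \<in> S" for z s
      using bspec[OF n(2) that] n(3) by (simp add: a)
    have \<alpha>: "0 \<le> \<alpha>"
    proof (rule ccontr)
      assume neg: "\<not> 0 \<le> \<alpha>"
      define z where "z = x0 + y0"
      obtain s where s: "(z, s) \<in> S" "s \<le> (\<alpha> * c - a \<bullet> z + 1) / \<alpha>"
        using below[OF H_pos[OF xy0]] unfolding z_def by blast
      have "\<alpha> * ((\<alpha> * c - a \<bullet> z + 1) / \<alpha>) \<le> \<alpha> * s"
        using s(2) neg by (intro mult_left_mono_neg) auto
      then show False
        using sep[OF s(1)] neg by simp
    qed
    show False
    proof (cases "\<alpha> = 0")
      case True
      have "a = 0"
      proof (rule support_not_in_halfspace)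
        fix x y assume "0 < F x" "0 < G y"
        then obtain s where "(x + y, s) \<in> S"
          using below[OF H_pos] by blast
        then show "a \<bullet> (x + y) \<le> 0"
          using sep True by fastforce
      qed
      then show False
        using n(1) True by (simp add: a zero_prod_def)
    next
      case False
      then have \<alpha>: "0 < \<alpha>"
        using \<alpha> by simp
      show False
      proof (rule tangent_bound_impossible)
        fix z assume Hz: "0 < H z"
        have h: "H z = ennreal (enn2real (H z))" "0 < enn2real (H z)"
          using H_finite[of z] Hz by (auto simp: enn2real_positive_iff)
        \<comment> \<open>\<open>S\<close> is strict, so only heights below \<open>ln (H z)\<close>
          are available; the bound at \<open>ln (H z)\<close> itself follows by density.\<close>
        have "s \<le> c + ((- 1 / \<alpha>) *\<^sub>R a) \<bullet> z" if "s < ln (enn2real (H z))" for s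
        proof -
          have "exp s < enn2real (H z)"
            using that h(2) by (metis exp_less_cancel_iff exp_ln)
          then have "(z, s) \<in> S"
            unfolding S_def by (subst (asm) ennreal_less_iff[symmetric]) (use h in auto)
          then show ?thesis
            using sep[of z s] \<alpha> by (simp add: field_simps)
        qed
        then have "ln (enn2real (H z)) \<le> c + ((- 1 / \<alpha>) *\<^sub>R a) \<bullet> z"
          by (rule dense_le)
        then show "ln (enn2real (H z)) \<le> ln (mF * mG / mQ) + sF + sG - 1 + ((- 1 / \<alpha>) *\<^sub>R a) \<bullet> z"
          by (simp add: c_def)
      qed
    qed
  qed
  then have "ennreal (exp c) < H 0"
    by (simp add: S_def)
  also have "H 0 = ennreal (LINT y|lborel. F y * G (- y))"
  proof -
    have "integrable lborel (\<lambda>y. F y * G (0 - y))"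
    proof (rule Bochner_Integration.integrable_bound)
      show "integrable lborel (\<lambda>y. K * F y)"
        using intF by simp
      show "AE y in lborel. norm (F y * G (0 - y)) \<le> norm (K * F y)"
        using F_nonneg G_nonneg G_le
        by (intro AE_I2) (auto simp: abs_mult mult.commute intro!: mult_left_mono order_trans[OF _ abs_ge_self])
    qed measurable
    then show ?thesis
      using F_nonneg G_nonneg by (subst nn_integral_eq_integral) auto
  qed
  finally have "exp c < (LINT y|lborel. F y * G (- y))"
    by (simp add: ennreal_less_iff)
  then have "exp c * (exp (1 - sF - sG) * mQ) \<le> (LINT y|lborel. F y * G (- y)) * (exp (1 - sF - sG) * mQ)"
    using pos by (intro mult_right_mono) auto
  also have "exp c * (exp (1 - sF - sG) * mQ) = exp (ln (mF * mG / mQ)) * mQ"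
    by (simp add: c_def exp_add[symmetric] mult.assoc[symmetric])
  also have "\<dots> = mF * mG"
    using pos by simp
  finally show ?thesis
    by (simp add: ac_simps)
qed

end

section \<open>Return to Lebesgue integrals and to the given functions\<close>

lemma AE_lebesgue_uminus:
  fixes P :: "'a::euclidean_space \<Rightarrow> bool"
  assumes "AE x in lebesgue. P x"
  shows "AE x in lebesgue. P (- x)"
proof -
  have "lborel = distr lborel borel (uminus :: 'a \<Rightarrow> 'a)"
    using lborel_affine[of "-1" "0::'a"] by (simp add: density_1)
  moreover have "AE x in lborel. P x"
    using assms by (simp add: AE_completion_iff)
  ultimately have "AE x in distr lborel borel uminus. P x"
    by (rule subst)
  then show ?thesis
    by (intro AE_completion AE_distrD[of uminus lborel borel]) auto
qed

text \<open>Turns the suprema inside the entropies of the theorem into factors that cancel those on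
  its left-hand side; what remains is \<open>mass_product_le\<close>.\<close>

lemma Ent_divide:
  fixes f :: "'a::euclidean_space \<Rightarrow> real"
  assumes f: "geom_concave f" and int: "integrable lborel (open_part f)"
    and ln: "integrable lborel (\<lambda>x. open_part f x * ln (open_part f x))"
    and pos: "0 < (LINT x|lborel. open_part f x)" and c: "0 < c"
  shows "Ent (\<lambda>x. f x / c)
    = ln c - (LINT x|lborel. open_part f x * ln (open_part f x)) / (LINT x|lborel. open_part f x)"
proof -
  let ?F = "open_part f"
  have ae: "AE x in lebesgue. f x = ?F x"
    by (rule AE_open_part[OF f])
  note [measurable] = borel_measurable_open_part[OF f]
  have "(LINT x|lebesgue. f x / c) = (LINT x|lborel. ?F x / c)"
  proof (rule integral_lebesgue_AE_borel)
    show "AE x in lebesgue. f x / c = ?F x / c"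
      using ae by eventually_elim simp
  qed measurable
  then have den: "(LINT x|lebesgue. f x / c) = (LINT x|lborel. ?F x) / c"
    by simp
  have "(LINT x|lebesgue. f x / c * ln (f x / c)) = (LINT x|lborel. ?F x / c * ln (?F x / c))"
  proof (rule integral_lebesgue_AE_borel)
    show "AE x in lebesgue. f x / c * ln (f x / c) = ?F x / c * ln (?F x / c)"
      using ae by eventually_elim simp
  qed measurable
  also have "\<dots> = (LINT x|lborel. ?F x * ln (?F x) / c - ?F x * (ln c / c))"
  proof (intro Bochner_Integration.integral_cong refl)
    fix x
    show "?F x / c * ln (?F x / c) = ?F x * ln (?F x) / c - ?F x * (ln c / c)"
      using geom_concave_nonneg[OF geom_concave_open_part[OF f], of x] c
      by (cases "?F x = 0") (auto simp: ln_div field_simps)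
  qed
  also have "\<dots> = (LINT x|lborel. ?F x * ln (?F x)) / c - (LINT x|lborel. ?F x) * (ln c / c)"
    using int ln by simp
  finally show ?thesis
    unfolding Ent_def den using pos c by (simp add: field_simps)
qed

theorem theorem1p1:
  fixes f g :: "real ^ 'n \<Rightarrow> real"
  assumes "log_concave f" and "log_concave g"
    and "integrable lebesgue f" and "integrable lebesgue g"
    and "(LINT x|lebesgue. f x) > 0" and "(LINT x|lebesgue. g x) > 0"
    and "barycenter f = - barycenter g"
    and "sup_norm f = f 0" and "sup_norm g = g 0"
  shows "sup_norm f * sup_norm g * (LINT x|lebesgue. f x) * (LINT y|lebesgue. g y)
    \<le> exp (1 + Ent (\<lambda>x. f x / sup_norm f) + Ent (\<lambda>x. g x / sup_norm g))
        * convolution f g 0 * (LINT z|lebesgue. asplund f g z)"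
proof -
  have f: "geom_concave f" and g: "geom_concave g"
    using assms by (auto intro: log_concave_imp_geom_concave)
  have max: "u x \<le> u 0"
    if "geom_concave u" "integrable lebesgue u" "0 < (LINT x|lebesgue. u x)" "sup_norm u = u 0"
    for u :: "real ^ 'n \<Rightarrow> real" and x
    using cSUP_upper[OF UNIV_I geom_concave_integrable_bounded[OF that(1-3)]] that(4)
    by (simp add: sup_norm_def)
  have f_max: "f x \<le> f 0" and g_max: "g x \<le> g 0" for x
    using max f g assms by auto
  obtain a C where a: "0 < a" and f_decay: "\<And>x. f x \<le> C * exp (- (a * norm x))"
    using geom_concave_exp_decay[OF f assms(3,5) f_max] by blast
  obtain b D where b: "0 < b" and g_decay: "\<And>x. g x \<le> D * exp (- (b * norm x))"
    using geom_concave_exp_decay[OF g assms(4,6) g_max] by blast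
  define F G Q where "F = open_part f" and "G = open_part g" and "Q = open_part (asplund f g)"
  note asplund = geom_concave_asplund[OF f g a b f_decay g_decay]
  have gc: "geom_concave F" "geom_concave G" "geom_concave Q"
    using f g asplund by (auto simp: F_def G_def Q_def geom_concave_open_part)
  have meas [measurable]: "F \<in> borel_measurable borel" "G \<in> borel_measurable borel" "Q \<in> borel_measurable borel"
    using f g asplund by (auto simp: F_def G_def Q_def)
  have ae: "AE x in lebesgue. f x = F x" "AE x in lebesgue. g x = G x" "AE x in lebesgue. asplund f g x = Q x"
    using f g asplund by (auto simp: F_def G_def Q_def AE_open_part)
  have mass: "(LINT x|lebesgue. f x) = (LINT x|lborel. F x)" "(LINT x|lebesgue. g x) = (LINT x|lborel. G x)"
    "(LINT x|lebesgue. asplund f g x) = (LINT x|lborel. Q x)"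
    using ae by (auto intro: integral_lebesgue_AE_borel)
  have int: "integrable lborel F" "integrable lborel G" "integrable lborel Q"
    using assms(3,4) integrable_lebesgue_AE_borel[OF ae(1)] integrable_lebesgue_AE_borel[OF ae(2)]
      integrable_open_part_asplund[OF f g a b f_decay g_decay] by (auto simp: Q_def)
  have F_decay: "F x \<le> C * exp (- (a * norm x))" and G_decay: "G x \<le> D * exp (- (b * norm x))" for x
    using open_part_le[OF f, of x] open_part_le[OF g, of x] f_decay[of x] g_decay[of x]
    by (auto simp: F_def G_def)
  have ln: "integrable lborel (\<lambda>x. F x * ln (F x))" "integrable lborel (\<lambda>x. G x * ln (G x))"
    and mom: "integrable lborel (\<lambda>x. F x *\<^sub>R x)" "integrable lborel (\<lambda>x. G x *\<^sub>R x)"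
    using integrable_mult_ln_of_exp_decay[OF meas(1) _ a F_decay] integrable_mult_ln_of_exp_decay[OF meas(2) _ b G_decay]
      integrable_scaleR_of_exp_decay[OF meas(1) _ a F_decay] integrable_scaleR_of_exp_decay[OF meas(2) _ b G_decay]
      geom_concave_nonneg gc by auto
  have "AE x in lebesgue. f x *\<^sub>R x = F x *\<^sub>R x" "AE x in lebesgue. g x *\<^sub>R x = G x *\<^sub>R x"
    using ae(1,2) by (eventually_elim, simp)+
  then have "(LINT x|lebesgue. f x *\<^sub>R x) = (LINT x|lborel. F x *\<^sub>R x)"
    "(LINT x|lebesgue. g x *\<^sub>R x) = (LINT x|lborel. G x *\<^sub>R x)"
    by (auto intro!: integral_lebesgue_AE_borel)
  then have bary: "(LINT x|lborel. F x *\<^sub>R x) /\<^sub>R (LINT x|lborel. F x)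
      = - ((LINT x|lborel. G x *\<^sub>R x) /\<^sub>R (LINT x|lborel. G x))"
    using assms(7) by (simp add: barycenter_def mass)
  have "AE y in lebesgue. f y * g (0 - y) = F y * G (- y)"
    using ae(1) AE_lebesgue_uminus[OF ae(2)] by eventually_elim simp
  then have conv: "convolution f g 0 = (LINT y|lborel. F y * G (- y))"
    unfolding convolution_def by (intro integral_lebesgue_AE_borel) auto
  \<comment> \<open>Since \<open>Q\<close> vanishes off the interior of the support, the change on a
    null set could spoil this pointwise bound. It survives because the sum of the two open supports
    is open and the Asplund product is positive on it.\<close>
  have upper: "F x * G y \<le> Q (x + y)" for x y
  proof (cases "0 < F x \<and> 0 < G y")
    case True
    let ?U = "interior {x. 0 < f x}" and ?V = "interior {x. 0 < g x}"
    have "(\<Union>x\<in>?U. \<Union>y\<in>?V. {x + y}) \<subseteq> interior {x. 0 < asplund f g x}"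
    proof (rule interior_maximal)
      show "open (\<Union>x\<in>?U. \<Union>y\<in>?V. {x + y})"
        by (intro open_sums disjI1 open_interior)
      show "(\<Union>x\<in>?U. \<Union>y\<in>?V. {x + y}) \<subseteq> {x. 0 < asplund f g x}"
      proof clarsimp
        fix x y assume "x \<in> ?U" "y \<in> ?V"
        then have "0 < f x * g y"
          using interior_subset by (intro mult_pos_pos) blast+
        then show "0 < asplund f g (x + y)"
          using asplund_upper[OF f g a b f_decay g_decay] by (rule less_le_trans)
      qed
    qed
    then have "x + y \<in> interior {x. 0 < asplund f g x}"
      using True by (auto simp: F_def G_def open_part_pos_iff)
    then have "Q (x + y) = asplund f g (x + y)"
      by (simp add: Q_def open_part_eq)
    moreover have "F x = f x" "G y = g y"
      using True by (auto simp: F_def G_def open_part_pos_iff open_part_eq)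
    ultimately show ?thesis
      using asplund_upper[OF f g a b f_decay g_decay] by simp
  next
    case False
    then have "F x = 0 \<or> G y = 0"
      using geom_concave_nonneg[OF gc(1), of x] geom_concave_nonneg[OF gc(2), of y] by auto
    then show ?thesis
      using geom_concave_nonneg[OF gc(3)] by auto
  qed
  have pos: "0 < (LINT x|lborel. F x)" "0 < (LINT x|lborel. G x)"
    using assms(5,6) by (simp_all add: mass)
  have fg0: "0 < f 0" "0 < g 0"
  proof -
    have "0 < u 0" if "\<And>x. u x \<le> u 0" "geom_concave u" "0 < (LINT x|lebesgue. u x)"
      for u :: "real ^ 'n \<Rightarrow> real"
    proof (rule ccontr)
      assume "\<not> 0 < u 0"
      then have "u x = 0" for x
        using that(1)[of x] geom_concave_nonneg[OF that(2), of x] by linarith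
      then show False
        using that(3) by simp
    qed
    then show "0 < f 0" "0 < g 0"
      using f_max g_max f g assms(5,6) by auto
  qed
  let ?s = "(LINT x|lborel. F x * ln (F x)) / (LINT x|lborel. F x)"
    and ?r = "(LINT x|lborel. G x * ln (G x)) / (LINT x|lborel. G x)"
  interpret opposite_barycenters F G Q "g 0"
  proof
    show "open {x. 0 < F x}" "open {x. 0 < G x}"
      by (simp_all add: F_def G_def open_part_pos_iff)
    show "G x \<le> g 0" for x
      using open_part_le[OF g, of x] g_max[of x] by (simp add: G_def)
  qed (use gc int pos ln mom bary upper geom_concave_nonneg meas in auto)
  have "Ent (\<lambda>x. f x / f 0) = ln (f 0) - ?s" "Ent (\<lambda>x. g x / g 0) = ln (g 0) - ?r"
    unfolding F_def G_def using f g int ln pos fg0 by (auto simp: F_def G_def intro!: Ent_divide)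
  then have "exp (1 + Ent (\<lambda>x. f x / f 0) + Ent (\<lambda>x. g x / g 0)) = f 0 * g 0 * exp (1 - ?s - ?r)"
    using fg0 by (simp add: exp_add exp_diff)
  then show ?thesis
    using mult_left_mono[OF mass_product_le, of "f 0 * g 0"] fg0 by (simp add: assms(8,9) conv mass ac_simps)
qed

end
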